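(* Let $a\le b$ be positive integers, let $S_{a,b}$ be the double star and let $m=a+b+1$ be its number of edges. Define \[ \tau_0=\left\lfloor(1+\sqrt{2})\left(m-\tfrac{3}{2}\right)\right\rfloor-1 \quad\text{and}\quad \tau_i=2m+i\ \text{ for } 1\le i\le 6. \] Then \[ \tau(S_{a,b})=\begin{cases} \min\{\tau_0,\tau_1\}, & 1\le a\le 2,\\ \min\{\tau_0,\tau_{a-1}\}, & 2\le a\le 6,\\ \min\{\tau_0,\tau_5\}, & a=7 \text{ and } b\le 21,\\ \min\{\tau_0,\tau_6\}, & a=7 \text{ and } b\ge 22, \text{ or } a\ge 8. \end{cases} \]
   Context: All graphs are simple. For a graph $G$ with $m$ edges, an antimagic labeling is a bijection $f:E(G)\to\{1,2,\dots,m\}$ such that the vertex sums $\phi(v)=\sum_{e\ni v} f(e)$, $v\in V(G)$, are pairwise distinct; $G$ is antimagic if it has an antimagic labeling. $G+H$ denotes the disjoint union of $G$ and $H$, and $cG$ the disjoint union of $c$ copies of $G$. $P_3$ is the path on 3 vertices. The double star $S_{a,b}$ is the tree consisting of one edge $xy$ (the internal edge) together with $a$ pendant edges attached at $x$ and $b$ pendant edges attached at $y$. For a graph $G$, $\tau(G)$ is the maximum integer such that $G+cP_3$ is antimagic for every integer $c$ with $0\le c\le \tau(G)$ (and $\tau(G)=-\infty$ if $G$ is not antimagic). *)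

theory Defs
  imports Complex_Main "HOL-Library.Extended"
begin

text \<open>An undirected graph is a set of vertices together with a set of edges, where an edge is the
  set of its two ends. The record carries no well-formedness condition; \<open>simple_graph\<close> below states
  it (finiteness included), and the lemmas show that all the graphs involved satisfy it.\<close>

record 'v ugraph =
  verts :: "'v set"
  edges :: "'v set set"

definition simple_graph :: "'v ugraph \<Rightarrow> bool" where
  "simple_graph G \<longleftrightarrow> finite (verts G) \<and> (\<forall>e\<in>edges G. e \<subseteq> verts G \<and> card e = 2)"

definition vertex_sum :: "'v ugraph \<Rightarrow> ('v set \<Rightarrow> nat) \<Rightarrow> 'v \<Rightarrow> nat" where
  "vertex_sum G f v = (\<Sum>e\<in>{e \<in> edges G. v \<in> e}. f e)"

definition antimagic_labeling :: "'v ugraph \<Rightarrow> ('v set \<Rightarrow> nat) \<Rightarrow> bool" where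
  "antimagic_labeling G f \<longleftrightarrow>
     bij_betw f (edges G) {1..card (edges G)} \<and> inj_on (vertex_sum G f) (verts G)"

definition antimagic :: "'v ugraph \<Rightarrow> bool" where
  "antimagic G \<longleftrightarrow> (\<exists>f. antimagic_labeling G f)"

definition disjoint_union :: "'v ugraph \<Rightarrow> 'w ugraph \<Rightarrow> ('v + 'w) ugraph" where
  "disjoint_union G H =
     \<lparr>verts = Inl ` verts G \<union> Inr ` verts H,
      edges = (`) Inl ` edges G \<union> (`) Inr ` edges H\<rparr>"

definition copies :: "nat \<Rightarrow> 'v ugraph \<Rightarrow> (nat \<times> 'v) ugraph" where
  "copies c G =
     \<lparr>verts = {..<c} \<times> verts G,
      edges = (\<Union>i<c. (`) (Pair i) ` edges G)\<rparr>"

definition path_graph :: "nat \<Rightarrow> nat ugraph" where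
  "path_graph n = \<lparr>verts = {..<n}, edges = {{i, i + 1} |i. i + 1 < n}\<rparr>"

text \<open>\<open>X\<close> and \<open>Y\<close> are the ends of the internal edge, \<open>LeafX i\<close> and \<open>LeafY j\<close> the leaves at them.\<close>

datatype ds_vertex = X | Y | LeafX nat | LeafY nat

definition double_star :: "nat \<Rightarrow> nat \<Rightarrow> ds_vertex ugraph" where
  "double_star a b =
     \<lparr>verts = {X, Y} \<union> LeafX ` {..<a} \<union> LeafY ` {..<b},
      edges = {{X, Y}} \<union> (\<lambda>i. {X, LeafX i}) ` {..<a} \<union> (\<lambda>j. {Y, LeafY j}) ` {..<b}\<rparr>"

text \<open>\<open>Minf\<close> is minus infinity. The value \<open>Pinf\<close> covers the graphs for which no maximum exists; in
  the last case the maximum does exist, so \<open>GREATEST\<close> is well defined.\<close>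

definition tau :: "'v ugraph \<Rightarrow> int extended" where
  "tau G =
     (if \<not> antimagic G then Minf
      else if \<forall>c. antimagic (disjoint_union G (copies c (path_graph 3))) then Pinf
      else Fin (GREATEST t::int. \<forall>c::nat. int c \<le> t \<longrightarrow>
             antimagic (disjoint_union G (copies c (path_graph 3)))))"

lemma simple_graph_disjoint_union:
  assumes "simple_graph G" "simple_graph H"
  shows "simple_graph (disjoint_union G H)"
proof -
  have "xb \<in> verts G" if "e \<in> edges G" "xb \<in> e" for e xb
    using assms that unfolding simple_graph_def by blast
  moreover have "xb \<in> verts H" if "e \<in> edges H" "xb \<in> e" for e xb
    using assms that unfolding simple_graph_def by blast
  ultimately show ?thesis
    using assms by (auto simp: simple_graph_def disjoint_union_def card_image)
qed

lemma simple_graph_copies: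
  assumes "simple_graph G"
  shows "simple_graph (copies c G)"
  using assms unfolding simple_graph_def copies_def
  by (auto simp: card_image inj_on_def)

lemma simple_graph_path_graph: "simple_graph (path_graph n)"
  unfolding simple_graph_def path_graph_def by auto

lemma path_graph_3: "path_graph 3 = \<lparr>verts = {0, 1, 2}, edges = {{0, 1}, {1, 2}}\<rparr>"
proof -
  have "{..<3} = {0, 1, 2::nat}" by auto
  moreover have "{{i, i + 1} |i. i + 1 < (3::nat)} = {{0, 1}, {1, 2}}"
  proof -
    have "{{i, i + 1} |i. i + 1 < (3::nat)} = (\<lambda>i. {i, i + 1}) ` {..<2}" by auto
    also have "{..<2} = {0, 1::nat}" by auto
    finally show ?thesis by (simp add: numeral_2_eq_2)
  qed
  ultimately show ?thesis by (simp add: path_graph_def)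
qed

lemma simple_graph_double_star: "simple_graph (double_star a b)"
  unfolding simple_graph_def double_star_def by auto

lemma card_edges_double_star: "card (edges (double_star a b)) = a + b + 1"
proof -
  have "card ((\<lambda>i. {X, LeafX i}) ` {..<a}) = a" "card ((\<lambda>j. {Y, LeafY j}) ` {..<b}) = b"
    by (subst card_image; force simp: inj_on_def doubleton_eq_iff)+
  moreover have "(\<lambda>i. {X, LeafX i}) ` {..<a} \<inter> (\<lambda>j. {Y, LeafY j}) ` {..<b} = {}"
    by (auto simp: doubleton_eq_iff)
  moreover have "{X, Y} \<notin> (\<lambda>i. {X, LeafX i}) ` {..<a} \<union> (\<lambda>j. {Y, LeafY j}) ` {..<b}"
    by (auto simp: doubleton_eq_iff)
  ultimately show ?thesis
    by (simp add: double_star_def card_Un_disjoint)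
qed

end

theory Submission
  imports Defs "HOL-Library.Code_Binary_Nat"
begin

text \<open>Let \<open>M = m + 2 * c\<close> be the number of edges. All labels but the label \<open>k\<close> of the internal edge \<open>XY\<close> are
  vertex sums of leaves, so the sums at \<open>X\<close>, \<open>Y\<close> and the centres of the paths are distinct numbers above \<open>M\<close>,
  except that one centre may have the sum \<open>k\<close>. Comparing the least possible total of these sums with
  the largest possible total of the labels involved gives all upper bounds: all centres together give \<open>\<tau> 0\<close>,
  the centres of the paths give \<open>2 * m + 6\<close>, and these together with \<open>X\<close> give the bounds for \<open>a \<le> 7\<close>.

  Conversely, one path is given labels with sum \<open>k\<close>, and the others pair up two intervals of labels in a
  zigzag, so that their sums fill an interval. The few labels that remain are split between \<open>X\<close> and \<open>Y\<close> so that
  both sums avoid this interval. This covers all cases but finitely many with \<open>m \<le> 15\<close>.\<close>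

subsection \<open>The edges as an index set\<close>

text \<open>Giving one centre the sum \<open>k\<close> has a second effect: its two labels can stand
  in for \<open>k\<close> in the sum at \<open>Y\<close>, so the sums at \<open>X\<close> and
  \<open>Y\<close> add up to the total of the leftover labels. What remains is to choose one set of
  labels at \<open>X\<close> with a suitable sum, and sets of fixed size in an interval realise
  every sum between the extremes.

  The obstacle is to find a place for the sum at \<open>X\<close> when \<open>c\<close> is close to
  \<open>2 * m + 6\<close>. The path sums then begin almost immediately above \<open>M\<close> and
  extend to about \<open>7 * m\<close>, which a few labels at \<open>X\<close> cannot exceed. The
  remaining holes are values just below the interval of path sums and a gap inside it. Zigzags of
  both parities, with or without one pair removed to free a large label, provide a hole in the right
  place. The sum at \<open>Y\<close> is harmless for large \<open>m\<close>: the total of the labels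
  up to \<open>m + 1\<close> or \<open>m + 2\<close> is quadratic in \<open>m\<close>, the path sums
  are linear.\<close>

text \<open>Indices for the edges, so that a labeling becomes a function on \<open>slots a b c\<close>.\<close>

datatype slot = SXY | SX nat | SY nat | SL nat | SR nat

definition slots :: "nat \<Rightarrow> nat \<Rightarrow> nat \<Rightarrow> slot set" where
  "slots a b c = {SXY} \<union> SX ` {..<a} \<union> SY ` {..<b} \<union> SL ` {..<c} \<union> SR ` {..<c}"

fun edge_of :: "slot \<Rightarrow> (ds_vertex + nat \<times> nat) set" where
  "edge_of SXY = {Inl X, Inl Y}"
| "edge_of (SX i) = {Inl X, Inl (LeafX i)}"
| "edge_of (SY i) = {Inl Y, Inl (LeafY i)}"
| "edge_of (SL i) = {Inr (i, 0), Inr (i, 1)}"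
| "edge_of (SR i) = {Inr (i, 1), Inr (i, 2)}"

abbreviation star_paths :: "nat \<Rightarrow> nat \<Rightarrow> nat \<Rightarrow> (ds_vertex + nat \<times> nat) ugraph" where
  "star_paths a b c \<equiv> disjoint_union (double_star a b) (copies c (path_graph 3))"

lemma inj_edge_of: "inj edge_of"
proof (rule injI)
  fix s t assume "edge_of s = edge_of t"
  then show "s = t"
    by (cases s; cases t) (auto simp: doubleton_eq_iff)
qed

lemma edges_star_paths: "edges (star_paths a b c) = edge_of ` slots a b c"
  by (auto simp: disjoint_union_def double_star_def copies_def path_graph_3 slots_def
      image_Un image_image image_UN)

lemma verts_star_paths:
  "verts (star_paths a b c) =
     (Inl ` LeafX ` {..<a} \<union> Inl ` LeafY ` {..<b} \<union> (\<lambda>i. Inr (i, 0)) ` {..<c} \<union> (\<lambda>i. Inr (i, 2)) ` {..<c})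
     \<union> ({Inl X, Inl Y} \<union> (\<lambda>i. Inr (i, 1)) ` {..<c})"
  by (auto simp: disjoint_union_def double_star_def copies_def path_graph_3)

fun slot_sum :: "nat \<Rightarrow> nat \<Rightarrow> (slot \<Rightarrow> nat) \<Rightarrow> ds_vertex + nat \<times> nat \<Rightarrow> nat" where
  "slot_sum a b l (Inl X) = l SXY + (\<Sum>i<a. l (SX i))"
| "slot_sum a b l (Inl Y) = l SXY + (\<Sum>i<b. l (SY i))"
| "slot_sum a b l (Inl (LeafX i)) = l (SX i)"
| "slot_sum a b l (Inl (LeafY i)) = l (SY i)"
| "slot_sum a b l (Inr (i, t)) =
     (if t = 0 then l (SL i) else if t = 1 then l (SL i) + l (SR i) else l (SR i))"

lemma finite_slots [simp]: "finite (slots a b c)"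
  by (simp add: slots_def)

lemma card_slots: "card (slots a b c) = a + b + 1 + 2 * c"
proof -
  have *: "card (SX ` {..<a}) = a" "card (SY ` {..<b}) = b" "card (SL ` {..<c}) = c"
    "card (SR ` {..<c}) = c"
    by (simp_all add: card_image inj_on_def)
  have "slots a b c = insert SXY ((SX ` {..<a} \<union> SY ` {..<b}) \<union> (SL ` {..<c} \<union> SR ` {..<c}))"
    by (auto simp: slots_def)
  also have "card \<dots> = Suc (card ((SX ` {..<a} \<union> SY ` {..<b}) \<union> (SL ` {..<c} \<union> SR ` {..<c})))"
    by (subst card_insert_disjoint) auto
  also have "card ((SX ` {..<a} \<union> SY ` {..<b}) \<union> (SL ` {..<c} \<union> SR ` {..<c})) =
      card (SX ` {..<a} \<union> SY ` {..<b}) + card (SL ` {..<c} \<union> SR ` {..<c})"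
    by (rule card_Un_disjoint) auto
  also have "card (SX ` {..<a} \<union> SY ` {..<b}) = a + b"
    by (subst card_Un_disjoint) (auto simp: *)
  also have "card (SL ` {..<c} \<union> SR ` {..<c}) = 2 * c"
    by (subst card_Un_disjoint) (auto simp: *)
  finally show ?thesis by simp
qed

lemma incident_star_paths:
  assumes "v \<in> verts (star_paths a b c)"
  shows "{e \<in> edges (star_paths a b c). v \<in> e} =
    edge_of ` (case v of Inl X \<Rightarrow> insert SXY (SX ` {..<a}) | Inl Y \<Rightarrow> insert SXY (SY ` {..<b})
      | Inl (LeafX i) \<Rightarrow> {SX i} | Inl (LeafY i) \<Rightarrow> {SY i}
      | Inr (i, t) \<Rightarrow> if t = 0 then {SL i} else if t = 1 then {SL i, SR i} else {SR i})"
    (is "_ = edge_of ` ?S")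
proof -
  have "{s \<in> slots a b c. v \<in> edge_of s} = ?S"
  proof (rule set_eqI)
    fix s show "s \<in> {s \<in> slots a b c. v \<in> edge_of s} \<longleftrightarrow> s \<in> ?S"
      using assms unfolding verts_star_paths slots_def by (cases s) auto
  qed
  moreover have "{e \<in> edge_of ` slots a b c. v \<in> e} = edge_of ` {s \<in> slots a b c. v \<in> edge_of s}"
    by blast
  ultimately show ?thesis by (simp add: edges_star_paths)
qed

lemma vertex_sum_star_paths:
  assumes "v \<in> verts (star_paths a b c)"
  shows "vertex_sum (star_paths a b c) f v = slot_sum a b (f \<circ> edge_of) v"
proof -
  have inj: "inj_on edge_of S" for S
    using inj_edge_of by (rule inj_on_subset) simp
  have "inj_on SX S" "inj_on SY S" for S
    by (auto simp: inj_on_def)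
  then have *: "sum g (insert SXY (SX ` {..<a})) = g SXY + (\<Sum>i<a. g (SX i))"
    "sum g (insert SXY (SY ` {..<b})) = g SXY + (\<Sum>i<b. g (SY i))" for g :: "slot \<Rightarrow> nat"
    by (subst sum.insert; force simp: sum.reindex)+
  show ?thesis
    using assms unfolding vertex_sum_def incident_star_paths[OF assms] sum.reindex[OF inj]
    unfolding verts_star_paths by (auto simp: *)
qed

lemma antimagic_star_paths_iff:
  "antimagic (star_paths a b c) \<longleftrightarrow>
     (\<exists>l. bij_betw l (slots a b c) {1..a + b + 1 + 2 * c} \<and>
          inj_on (slot_sum a b l) (verts (star_paths a b c)))"
    (is "?A \<longleftrightarrow> ?B")
proof -
  have inj: "inj_on edge_of S" for S
    using inj_edge_of by (rule inj_on_subset) simp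
  have card: "card (edges (star_paths a b c)) = a + b + 1 + 2 * c"
    by (simp add: edges_star_paths card_image[OF inj] card_slots)
  have bij: "bij_betw edge_of (slots a b c) (edges (star_paths a b c))"
    by (simp add: bij_betw_def inj edges_star_paths)
  have sums: "inj_on (vertex_sum (star_paths a b c) f) (verts (star_paths a b c)) \<longleftrightarrow>
      inj_on (slot_sum a b (f \<circ> edge_of)) (verts (star_paths a b c))" for f
    by (rule inj_on_cong) (rule vertex_sum_star_paths)
  show ?thesis
  proof
    assume ?A
    then obtain f where f: "antimagic_labeling (star_paths a b c) f"
      unfolding antimagic_def by blast
    then show ?B
      using bij_betw_trans[OF bij] sums card unfolding antimagic_labeling_def by metis
  next
    assume ?B
    then obtain l where l: "bij_betw l (slots a b c) {1..a + b + 1 + 2 * c}"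
      "inj_on (slot_sum a b l) (verts (star_paths a b c))" by blast
    define f where "f = l \<circ> inv edge_of"
    have "f \<circ> edge_of = l"
      by (simp add: f_def comp_def inj_edge_of)
    moreover have "bij_betw f (edges (star_paths a b c)) {1..a + b + 1 + 2 * c}"
      using bij l(1) \<open>f \<circ> edge_of = l\<close> bij_betw_comp_iff by blast
    ultimately show ?A
      using l(2) sums[of f] card unfolding antimagic_def antimagic_labeling_def by auto
  qed
qed

text \<open>\<open>tau\<close> first tests the double star itself, which differs in type from its
  union with zero paths; the labeling is transported along \<open>Inl\<close>.\<close>

lemma antimagic_double_star:
  assumes "antimagic (star_paths a b 0)"
  shows "antimagic (double_star a b)"
proof -
  have inj: "inj_on ((`) Inl) S" for S :: "ds_vertex set set"
    by (auto simp: inj_on_def inj_image_eq_iff)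
  have e: "edges (star_paths a b 0) = (`) Inl ` edges (double_star a b)"
    and v: "verts (star_paths a b 0) = Inl ` verts (double_star a b)"
    by (auto simp: disjoint_union_def copies_def)
  obtain f where f: "antimagic_labeling (star_paths a b 0) f"
    using assms unfolding antimagic_def by blast
  have s: "vertex_sum (star_paths a b 0) f (Inl x) = vertex_sum (double_star a b) (\<lambda>e. f (Inl ` e)) x" for x
  proof -
    have "{e \<in> edges (star_paths a b 0). Inl x \<in> e} = (`) Inl ` {e \<in> edges (double_star a b). x \<in> e}"
      unfolding e by auto
    then show ?thesis
      unfolding vertex_sum_def by (simp add: sum.reindex[OF inj])
  qed
  have "antimagic_labeling (double_star a b) (\<lambda>e. f (Inl ` e))"
    unfolding antimagic_labeling_def
  proof
    have "bij_betw ((`) Inl :: ds_vertex set \<Rightarrow> _) (edges (double_star a b)) (edges (star_paths a b 0))"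
      by (simp add: bij_betw_def inj e)
    moreover have "bij_betw f (edges (star_paths a b 0)) {1..card (edges (double_star a b))}"
      using f unfolding antimagic_labeling_def e by (simp add: card_image[OF inj])
    ultimately show "bij_betw (\<lambda>e. f (Inl ` e)) (edges (double_star a b)) {1..card (edges (double_star a b))}"
      using bij_betw_trans by (fastforce simp: comp_def)
    show "inj_on (vertex_sum (double_star a b) (\<lambda>e. f (Inl ` e))) (verts (double_star a b))"
      using f unfolding antimagic_labeling_def v by (auto simp: inj_on_def s)
  qed
  then show ?thesis
    unfolding antimagic_def by blast
qed

subsection \<open>Upper bounds\<close>

text \<open>The extreme set is \<open>{M + 1..M + card D}\<close>: each new maximum exceeds
  \<open>M\<close> by at least the new cardinality. This bound and its mirror image below are
  doubled to avoid division.\<close>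

lemma sum_distinct_ge:
  fixes D :: "nat set"
  assumes "finite D" "\<forall>x\<in>D. M < x"
  shows "2 * card D * M + card D * (card D + 1) \<le> 2 * \<Sum>D"
  using assms
proof (induction D rule: finite_linorder_max_induct)
  case (insert b A)
  have "A \<subseteq> {M<..<b}"
    using insert.hyps(2) insert.prems by auto
  then have "card A \<le> card {M<..<b}"
    by (rule card_mono[rotated]) simp
  then have "M + card A + 1 \<le> b"
    using insert.prems by auto
  moreover have "b \<notin> A"
    using insert.hyps(2) by auto
  ultimately show ?case
    using insert by (simp add: algebra_simps)
qed simp

lemma sum_distinct_le:
  fixes D :: "nat set"
  assumes "finite D" "D \<subseteq> {1..M}"
  shows "2 * \<Sum>D + card D * card D \<le> card D * (2 * M + 1)"
  using assms
proof (induction D rule: finite_linorder_min_induct)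
  case (insert b A)
  have "A \<subseteq> {b<..M}"
    using insert.hyps(2) insert.prems by auto
  then have "card A \<le> card {b<..M}"
    by (rule card_mono[rotated]) simp
  then have "b + card A \<le> M"
    using insert.prems by auto
  moreover have "b \<notin> A"
    using insert.hyps(2) by auto
  ultimately show ?case
    using insert by (simp add: algebra_simps)
qed simp

lemma twice_sum_atLeastAtMost_1: "2 * \<Sum>{1..n} = n * (n + 1)" for n :: nat
  by (induction n) auto

text \<open>Here \<open>j\<close> is the number of paths whose centre does not have the label of \<open>XY\<close> as its sum.\<close>

lemma antimagic_necessary:
  assumes "antimagic (star_paths a b c)" "1 \<le> a" "1 \<le> b" and M: "M = a + b + 1 + 2 * c"
  obtains j where "j = c \<or> j + 1 = c"
    "2 * (c + 1) * M + (c + 1) * (c + 2) \<le> M * (M + 1)"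
    "2 * j * M + j * (j + 1) + (2 * j) * (2 * j) \<le> (2 * j) * (2 * M + 1)"
    "2 * (j + 1) * M + (j + 1) * (j + 2) + (2 * j + a + 1) * (2 * j + a + 1)
       \<le> (2 * j + a + 1) * (2 * M + 1)"
proof -
  obtain l where bij: "bij_betw l (slots a b c) {1..M}"
    and inj: "inj_on (slot_sum a b l) (verts (star_paths a b c))"
    using assms(1) unfolding antimagic_star_paths_iff M by blast
  define k where "k = l SXY"
  define x where "x = slot_sum a b l (Inl X)"
  define y where "y = slot_sum a b l (Inl Y)"
  define s where "s = (\<lambda>i. l (SL i) + l (SR i))"
  define J where "J = {i \<in> {..<c}. s i \<noteq> k}"
  have x: "x = k + (\<Sum>i<a. l (SX i))" and y: "y = k + (\<Sum>i<b. l (SY i))"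
    by (simp_all add: x_def y_def k_def)
  have l_pos: "1 \<le> l u \<and> l u \<le> M" if "u \<in> slots a b c" for u
    using bij_betwE[OF bij] that by auto
  have l_inj: "inj_on l (slots a b c)"
    using bij by (rule bij_betw_imp_inj_on)
  have l_eq: "l u = l v \<longleftrightarrow> u = v" if "u \<in> slots a b c" "v \<in> slots a b c" for u v
    using l_inj that by (simp add: inj_on_eq_iff)
  \<comment> \<open>A sum that equals a label other than \<open>k\<close> collides with the leaf on
    the edge carrying that label.\<close>
  have big: "M < slot_sum a b l v \<or> slot_sum a b l v = k"
    if v: "v \<in> {Inl X, Inl Y} \<union> (\<lambda>i. Inr (i, 1)) ` {..<c}" "1 \<le> slot_sum a b l v" for v
  proof (rule ccontr)
    assume *: "\<not> ?thesis"
    then have "slot_sum a b l v \<in> l ` slots a b c"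
      using bij v(2) by (auto simp: bij_betw_def)
    then obtain u where u: "u \<in> slots a b c" "l u = slot_sum a b l v"
      by auto
    moreover have "u \<noteq> SXY"
      using * u(2) by (auto simp: k_def)
    ultimately obtain w where "slot_sum a b l w = l u" "w \<in> verts (star_paths a b c)"
      "w \<notin> {Inl X, Inl Y} \<union> (\<lambda>i. Inr (i, 1)) ` {..<c}"
    proof (cases u)
      case (SX i)
      then show ?thesis using u that[of "Inl (LeafX i)"] by (auto simp: slots_def verts_star_paths image_iff)
    next
      case (SY i)
      then show ?thesis using u that[of "Inl (LeafY i)"] by (auto simp: slots_def verts_star_paths image_iff)
    next
      case (SL i)
      then show ?thesis using u that[of "Inr (i, 0)"] by (auto simp: slots_def verts_star_paths image_iff)
    next
      case (SR i)
      then show ?thesis using u that[of "Inr (i, 2)"] by (auto simp: slots_def verts_star_paths image_iff)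
    qed simp
    moreover have "v \<in> verts (star_paths a b c)"
      using v(1) by (auto simp: verts_star_paths)
    ultimately show False
      using inj_onD[OF inj, of v w] u(2) v(1) by metis
  qed
  have k: "1 \<le> k" "k \<le> M"
    using l_pos[of SXY] by (auto simp: k_def slots_def)
  have pos: "1 \<le> (\<Sum>i<a. l (SX i))" "1 \<le> (\<Sum>i<b. l (SY i))"
    using member_le_sum[of 0 "{..<a}" "\<lambda>i. l (SX i)"] member_le_sum[of 0 "{..<b}" "\<lambda>i. l (SY i)"]
      l_pos[of "SX 0"] l_pos[of "SY 0"] assms(2,3) by (auto simp: slots_def)
  have x_big: "M < x" and y_big: "M < y"
    using big[of "Inl X"] big[of "Inl Y"] pos by (auto simp: x y k_def)
  have s_sum: "s i = slot_sum a b l (Inr (i, 1))" for i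
    by (simp add: s_def)
  have s_big: "M < s i" if "i \<in> J" for i
    using big[of "Inr (i, 1)"] that l_pos[of "SL i"] by (auto simp: J_def s_def slots_def)
  have s_inj: "inj_on s {..<c}"
  proof (rule inj_onI)
    fix i j assume "i \<in> {..<c}" "j \<in> {..<c}" "s i = s j"
    then have "(Inr (i, 1) :: ds_vertex + nat \<times> nat) = Inr (j, 1)"
      by (intro inj_onD[OF inj]) (simp_all add: s_def verts_star_paths)
    then show "i = j" by simp
  qed
  have ne: "x \<noteq> y" "\<And>i. i < c \<Longrightarrow> s i \<noteq> x" "\<And>i. i < c \<Longrightarrow> s i \<noteq> y"
    using inj_onD[OF inj, of "Inl X" "Inl Y"] inj_onD[OF inj, of "Inr (_, 1)" "Inl X"]
      inj_onD[OF inj, of "Inr (_, 1)" "Inl Y"]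
    unfolding x_def y_def s_sum verts_star_paths by blast+
  have J: "J \<subseteq> {..<c}" "finite J"
    by (auto simp: J_def)
  have sJ_inj: "inj_on s J"
    using s_inj J(1) by (rule inj_on_subset)
  have J_or: "(J = {..<c} \<or> (\<exists>i0<c. s i0 = k \<and> J = {..<c} - {i0}))"
    using s_inj by (force simp: J_def inj_on_def)
  \<comment> \<open>\<open>k\<close> is counted both at \<open>X\<close> and at \<open>Y\<close>,
    hence once more than among the labels.\<close>
  have total: "x + y + (\<Sum>i<c. s i) = k + \<Sum>{1..M}"
  proof -
    have "\<Sum>{1..M} = sum l (slots a b c)"
      using bij sum.reindex_bij_betw[OF bij, of "\<lambda>x. x"] by simp
    also have "\<dots> = l SXY + (\<Sum>i<a. l (SX i)) + (\<Sum>i<b. l (SY i)) + (\<Sum>i<c. l (SL i)) + (\<Sum>i<c. l (SR i))"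
    proof -
      have inj: "inj_on SX S" "inj_on SY S" "inj_on SL S" "inj_on SR S" for S
        by (auto simp: inj_on_def)
      have "slots a b c = insert SXY ((SX ` {..<a} \<union> SY ` {..<b}) \<union> (SL ` {..<c} \<union> SR ` {..<c}))"
        by (auto simp: slots_def)
      also have "sum l \<dots> = l SXY + sum l ((SX ` {..<a} \<union> SY ` {..<b}) \<union> (SL ` {..<c} \<union> SR ` {..<c}))"
        by (subst sum.insert) auto
      also have "sum l ((SX ` {..<a} \<union> SY ` {..<b}) \<union> (SL ` {..<c} \<union> SR ` {..<c})) =
          sum l (SX ` {..<a} \<union> SY ` {..<b}) + sum l (SL ` {..<c} \<union> SR ` {..<c})"
        by (rule sum.union_disjoint) auto
      also have "sum l (SX ` {..<a} \<union> SY ` {..<b}) = sum l (SX ` {..<a}) + sum l (SY ` {..<b})"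
        by (rule sum.union_disjoint) auto
      also have "sum l (SL ` {..<c} \<union> SR ` {..<c}) = sum l (SL ` {..<c}) + sum l (SR ` {..<c})"
        by (rule sum.union_disjoint) auto
      finally have "sum l (slots a b c) = l SXY + (sum l (SX ` {..<a}) + sum l (SY ` {..<b})
         + (sum l (SL ` {..<c}) + sum l (SR ` {..<c})))" .
      then show ?thesis by (simp add: sum.reindex inj)
    qed
    finally show ?thesis
      by (simp add: x y s_def sum.distrib k_def)
  qed
  have sum_s: "\<Sum>(s ` J) = (\<Sum>i\<in>J. s i)" and card_s: "card (s ` J) = card J"
    using sJ_inj by (simp_all add: sum.reindex card_image)
  have fin: "finite (s ` J)" and notin: "x \<notin> s ` J" "y \<notin> s ` J"
    using J ne by auto
  define S where "S = SL ` J \<union> SR ` J"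
  have S: "S \<subseteq> slots a b c" "finite S"
    using J by (auto simp: S_def slots_def)
  have card_S: "card S = 2 * card J"
    unfolding S_def by (subst card_Un_disjoint) (auto simp: J card_image inj_on_def)
  have sum_S: "sum l S = (\<Sum>i\<in>J. s i)"
    unfolding S_def s_def by (subst sum.union_disjoint) (auto simp: J sum.reindex inj_on_def sum.distrib)
  have labels_le: "2 * sum l Q + card Q * card Q \<le> card Q * (2 * M + 1)" if "Q \<subseteq> slots a b c" for Q
  proof -
    have "inj_on l Q" "l ` Q \<subseteq> {1..M}"
      using that l_pos inj_on_subset[OF l_inj] by auto
    then show ?thesis
      using sum_distinct_le[of "l ` Q" M] that finite_subset[OF that]
      by (simp add: card_image sum.reindex)
  qed
  show ?thesis
  proof (rule that)
    show "card J = c \<or> card J + 1 = c"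
      using J_or by auto
    show "2 * (c + 1) * M + (c + 1) * (c + 2) \<le> M * (M + 1)"
      using J_or
    proof
      \<comment> \<open>Here there are \<open>c + 2\<close> numbers above \<open>M\<close>; the
        additional one pays for the surplus \<open>k \<le> M\<close>.\<close>
      assume "J = {..<c}"
      then have *: "card (insert x (insert y (s ` J))) = c + 2"
        "\<Sum>(insert x (insert y (s ` J))) = k + \<Sum>{1..M}"
        using fin notin ne(1) card_s sum_s total by auto
      show ?thesis
        using sum_distinct_ge[of "insert x (insert y (s ` J))" M] fin x_big y_big s_big k(2)
        unfolding * using twice_sum_atLeastAtMost_1[of M] by (auto simp: algebra_simps)
    next
      assume "\<exists>i0<c. s i0 = k \<and> J = {..<c} - {i0}"
      then obtain i0 where i0: "i0 < c" "s i0 = k" "J = {..<c} - {i0}" by blast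
      have "(\<Sum>i<c. s i) = k + (\<Sum>i\<in>J. s i)"
        using i0 by (subst sum.remove[of _ i0]) auto
      then have *: "card (insert x (insert y (s ` J))) = c + 1"
        "\<Sum>(insert x (insert y (s ` J))) = \<Sum>{1..M}"
        using fin notin ne(1) card_s sum_s total i0 by auto
      show ?thesis
        using sum_distinct_ge[of "insert x (insert y (s ` J))" M] fin x_big y_big s_big
        unfolding * using twice_sum_atLeastAtMost_1[of M] by (auto simp: algebra_simps)
    qed
    \<comment> \<open>The centres in \<open>J\<close> use \<open>2 * card J\<close> labels, at best
      the largest ones. For \<open>j > 0\<close> this amounts to
      \<open>5 * j \<le> 2 * M + 1\<close>.\<close>
    show "2 * card J * M + card J * (card J + 1) + (2 * card J) * (2 * card J) \<le> (2 * card J) * (2 * M + 1)"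
      using sum_distinct_ge[of "s ` J" M] fin s_big labels_le[OF S(1)]
      unfolding card_s sum_s sum_S card_S by (auto simp: algebra_simps)
    have "insert SXY (SX ` {..<a}) \<inter> S = {}"
      by (auto simp: S_def)
    then have "sum l (insert SXY (SX ` {..<a}) \<union> S) = x + (\<Sum>i\<in>J. s i)"
      "card (insert SXY (SX ` {..<a}) \<union> S) = 2 * card J + a + 1"
      using S(2) sum_S card_S
      by (auto simp: sum.union_disjoint card_Un_disjoint x k_def sum.reindex inj_on_def card_insert_if card_image
        sum.insert_if)
    moreover have "insert SXY (SX ` {..<a}) \<union> S \<subseteq> slots a b c"
      using S(1) by (auto simp: slots_def)
    ultimately have "2 * (x + (\<Sum>i\<in>J. s i)) + (2 * card J + a + 1) * (2 * card J + a + 1)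
       \<le> (2 * card J + a + 1) * (2 * M + 1)"
      using labels_le by metis
    moreover have "2 * (card J + 1) * M + (card J + 1) * (card J + 2) \<le> 2 * (x + (\<Sum>i\<in>J. s i))"
      using sum_distinct_ge[of "insert x (s ` J)" M] fin s_big x_big notin card_s sum_s by auto
    ultimately show "2 * (card J + 1) * M + (card J + 1) * (card J + 2) + (2 * card J + a + 1) * (2 * card J + a + 1)
       \<le> (2 * card J + a + 1) * (2 * M + 1)"
      by linarith
  qed
qed

subsection \<open>Labelings from leftover labels\<close>

primrec leaf_of :: "slot \<Rightarrow> ds_vertex + nat \<times> nat" where
  "leaf_of SXY = undefined"
| "leaf_of (SX i) = Inl (LeafX i)"
| "leaf_of (SY i) = Inl (LeafY i)"
| "leaf_of (SL i) = Inr (i, 0)"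
| "leaf_of (SR i) = Inr (i, 2)"

lemma verts_star_paths_leaf_of:
  "verts (star_paths a b c) =
     leaf_of ` (slots a b c - {SXY}) \<union> ({Inl X, Inl Y} \<union> (\<lambda>i. Inr (i, 1)) ` {..<c})"
proof -
  have "slots a b c - {SXY} = SX ` {..<a} \<union> SY ` {..<b} \<union> SL ` {..<c} \<union> SR ` {..<c}"
    by (auto simp: slots_def)
  then show ?thesis
    by (simp add: verts_star_paths image_Un image_image)
qed

lemma slot_sum_leaf_of:
  "u \<noteq> SXY \<Longrightarrow> slot_sum a b l (leaf_of u) = l u"
  by (cases u) auto

lemma inj_on_UnI:
  assumes "inj_on f A" "inj_on f B" "\<And>v. v \<in> B \<Longrightarrow> f v \<notin> f ` A"
  shows "inj_on f (A \<union> B)"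
proof -
  have "y \<notin> f ` A" if "y \<in> f ` B" for y
    using that assms(3) by (elim imageE) simp
  then have "f ` (A - B) \<inter> f ` (B - A) = {}"
    by blast
  then show ?thesis
    using assms(1,2) by (simp only: inj_on_Un)
qed

text \<open>The leftover labels \<open>U\<close> are distributed to the double star and to one path, whose two
  labels \<open>i\<close> and \<open>j\<close> add up to the label \<open>k\<close> of the edge \<open>XY\<close>; \<open>E\<close> is the set of labels at \<open>X\<close>.\<close>

lemma antimagic_sufficient:
  fixes p q :: "'i \<Rightarrow> nat"
  assumes I: "finite I" "card I + 1 = c" and M: "M = a + b + 1 + 2 * c"
    and pq: "inj_on p I" "inj_on q I" "p ` I \<inter> q ` I = {}" "U \<inter> (p ` I \<union> q ` I) = {}"
      "U \<union> (p ` I \<union> q ` I) = {1..M}"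
    and E: "E \<subseteq> U" "card E = a + 1" "k \<in> E" "i \<in> U - E" "j \<in> U - E" "i \<noteq> j" "i + j = k"
    and inj: "inj_on (\<lambda>t. p t + q t) I"
    and big: "\<And>t. t \<in> I \<Longrightarrow> M < p t + q t" "M < \<Sum>E" "M + \<Sum>E < \<Sum>U"
    and ne: "\<And>t. t \<in> I \<Longrightarrow> p t + q t \<noteq> \<Sum>E" "\<And>t. t \<in> I \<Longrightarrow> p t + q t + \<Sum>E \<noteq> \<Sum>U"
      "2 * \<Sum>E \<noteq> \<Sum>U"
  shows "antimagic (star_paths a b c)"
proof -
  have fin: "finite U" "finite E" "finite (U - E)"
    using pq(5) finite_subset[OF E(1)] by (metis finite_Un finite_atLeastAtMost finite_subset E(1) finite_Diff)+
  have "card U + (card I + card I) = M"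
    using card_Un_disjoint[of U "p ` I \<union> q ` I"] card_Un_disjoint[of "p ` I" "q ` I"] pq I fin
    by (simp add: card_image)
  then have card_U: "card U = a + b + 3"
    using I M by simp
  define B where "B = U - E - {i, j}"
  have card_B: "card B = b" and fin_B: "finite B"
    using E fin card_U by (auto simp: B_def card_Diff_subset)
  \<comment> \<open>Since \<open>i + j = k\<close>, the sum \<open>k + \<Sum>B\<close> at
    \<open>Y\<close> equals \<open>\<Sum>U - \<Sum>E\<close>. This is why the conditions on the sums
    need only \<open>E\<close> and \<open>U\<close>.\<close>
  have sum_U: "\<Sum>U = \<Sum>E + (i + j + \<Sum>B)"
  proof -
    have "\<Sum>U = \<Sum>E + \<Sum>(U - E)"
      using sum.subset_diff[OF E(1) fin(1), of "\<lambda>x. x"] by simp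
    also have "\<Sum>(U - E) = \<Sum>B + \<Sum>{i, j}"
      unfolding B_def by (rule sum.subset_diff) (use E fin in auto)
    finally show ?thesis using E(6) by simp
  qed
  have "card (E - {k}) = a" "finite (E - {k})"
    using E fin by auto
  then obtain \<alpha> where \<alpha>: "bij_betw \<alpha> {..<a} (E - {k})"
    using ex_bij_betw_nat_finite[of "E - {k}"] by (auto simp: atLeast0LessThan)
  obtain \<beta> where \<beta>: "bij_betw \<beta> {..<b} B"
    using ex_bij_betw_nat_finite[OF fin_B] card_B by (auto simp: atLeast0LessThan)
  obtain \<gamma> where \<gamma>: "bij_betw \<gamma> {..<c - 1} I"
    using ex_bij_betw_nat_finite[OF I(1)] I(2) by (auto simp: atLeast0LessThan)
  define d where "d = c - 1"
  have c: "c = Suc d"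
    using I(2) by (simp add: d_def)
  \<comment> \<open>The last path, number \<open>d\<close>, is the one with the labels
    \<open>i\<close> and \<open>j\<close>.\<close>
  define l where "l = (\<lambda>u. case u of SXY \<Rightarrow> k | SX n \<Rightarrow> \<alpha> n | SY n \<Rightarrow> \<beta> n
    | SL n \<Rightarrow> if n = d then i else p (\<gamma> n) | SR n \<Rightarrow> if n = d then j else q (\<gamma> n))"
  have \<gamma>': "bij_betw \<gamma> {..<d} I"
    using \<gamma> by (simp add: d_def)
  have lessThan: "{..<c} = insert d {..<d}"
    using c by auto
  have "l ` SL ` {..<c} = insert i (p ` \<gamma> ` {..<d})" "l ` SR ` {..<c} = insert j (q ` \<gamma> ` {..<d})"
    by (auto simp: lessThan l_def image_iff)
  then have lLR: "l ` SL ` {..<c} = insert i (p ` I)" "l ` SR ` {..<c} = insert j (q ` I)"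
    using bij_betw_imp_surj_on[OF \<gamma>'] by simp_all
  have "l ` SX ` {..<a} = E - {k}" "l ` SY ` {..<b} = B"
    using bij_betw_imp_surj_on[OF \<alpha>] bij_betw_imp_surj_on[OF \<beta>] by (simp_all add: l_def image_image)
  then have "l ` slots a b c = {k} \<union> (E - {k}) \<union> B \<union> insert i (p ` I) \<union> insert j (q ` I)"
    unfolding slots_def image_Un lLR by (simp add: l_def)
  also have "\<dots> = U \<union> (p ` I \<union> q ` I)"
    using E by (auto simp: B_def)
  finally have l_img: "l ` slots a b c = {1..M}"
    using pq(5) by simp
  then have l_inj: "inj_on l (slots a b c)"
    by (intro eq_card_imp_inj_on) (simp_all add: card_slots M)
  define f where "f = slot_sum a b l"
  have fX: "f (Inl X) = \<Sum>E"
  proof -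
    have "(\<Sum>n<a. l (SX n)) = \<Sum>(E - {k})"
      using sum.reindex_bij_betw[OF \<alpha>, of "\<lambda>x. x"] by (simp add: l_def)
    then show ?thesis
      using E fin sum.remove[of E k "\<lambda>x. x"] by (simp add: f_def l_def)
  qed
  have fY: "f (Inl Y) + \<Sum>E = \<Sum>U"
    using sum.reindex_bij_betw[OF \<beta>, of "\<lambda>x. x"] sum_U E(7) by (simp add: f_def l_def)
  have fC: "f (Inr (n, 1)) = (if n = d then k else p (\<gamma> n) + q (\<gamma> n))" for n
    using E(7) by (simp add: f_def l_def)
  have k: "k \<le> M"
    using E pq(5) by auto
  have \<gamma>I: "\<gamma> n \<in> I" if "n < d" for n
    using bij_betwE[OF \<gamma>'] that by auto
  let ?C = "{Inl X, Inl Y} \<union> (\<lambda>i. Inr (i, 1)) ` {..<c}"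
  let ?L = "leaf_of ` (slots a b c - {SXY})"
  have leaf: "inj_on f ?L"
  proof (rule inj_on_imageI)
    have "inj_on l (slots a b c - {SXY})"
      using l_inj by (rule inj_on_subset) blast
    then show "inj_on (f \<circ> leaf_of) (slots a b c - {SXY})"
      by (rule inj_on_cong[THEN iffD1, rotated]) (simp add: f_def slot_sum_leaf_of)
  qed
  \<comment> \<open>\<open>k\<close> is missing among the leaf sums, so the centre of path
    \<open>d\<close> may have it.\<close>
  have f_leaf: "f ` ?L = {1..M} - {k}"
  proof -
    have "f ` ?L = l ` (slots a b c - {SXY})"
      unfolding image_image by (rule image_cong) (auto simp: f_def slot_sum_leaf_of)
    also have "\<dots> = l ` slots a b c - l ` {SXY}"
      by (rule inj_on_image_set_diff[OF l_inj]) (auto simp: slots_def)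
    finally show ?thesis
      using l_img by (simp add: l_def)
  qed
  have f_center: "M < f v \<or> f v = k" if "v \<in> ?C" for v
    using that big fX fY fC \<gamma>I unfolding lessThan by fastforce
  have center: "inj_on f ?C"
  proof -
    have "inj_on f ((\<lambda>i. Inr (i, 1)) ` {..<c})"
    proof (rule inj_on_imageI, unfold comp_def, rule inj_onI)
      fix n n' assume n: "n \<in> {..<c}" "n' \<in> {..<c}" and "f (Inr (n, 1)) = f (Inr (n', 1))"
      then have eq: "(if n = d then k else p (\<gamma> n) + q (\<gamma> n)) = (if n' = d then k else p (\<gamma> n') + q (\<gamma> n'))"
        by (simp only: fC)
      show "n = n'"
      proof (cases "n = d \<or> n' = d")
        case True
        then show ?thesis
          using eq n big(1)[OF \<gamma>I, of n] big(1)[OF \<gamma>I, of n'] k c by (auto split: if_splits)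
      next
        case False
        then have "n < d" "n' < d" using n c by auto
        moreover from this have "\<gamma> n = \<gamma> n'"
          using eq False inj \<gamma>I by (auto dest: inj_onD)
        ultimately show ?thesis
          using bij_betw_imp_inj_on[OF \<gamma>'] by (auto dest: inj_onD)
      qed
    qed
    moreover have "f (Inl X) \<noteq> f (Inl Y)"
      using fX fY ne(3) by auto
    moreover have "f (Inl X) \<noteq> f (Inr (n, 1))" "f (Inl Y) \<noteq> f (Inr (n, 1))" if "n < c" for n
      using that ne(1,2)[OF \<gamma>I, of n] big(2,3) fX fY k c unfolding fC by auto
    then have "f (Inl X) \<notin> f ` (\<lambda>i. Inr (i, 1)) ` {..<c}" "f (Inl Y) \<notin> f ` (\<lambda>i. Inr (i, 1)) ` {..<c}"
      unfolding image_image by blast+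
    ultimately show ?thesis
      by (simp add: inj_on_insert del: One_nat_def) blast
  qed
  have "f v \<notin> f ` ?L" if "v \<in> ?C" for v
    using f_center[OF that] unfolding f_leaf by auto
  then have "inj_on f (verts (star_paths a b c))"
    unfolding verts_star_paths_leaf_of by (rule inj_on_UnI[OF leaf center])
  moreover have "bij_betw l (slots a b c) {1..a + b + 1 + 2 * c}"
    using l_inj l_img M by (simp add: bij_betw_def)
  ultimately show ?thesis
    unfolding antimagic_star_paths_iff f_def by blast
qed

subsection \<open>Subsets with prescribed sum and zigzag pairings\<close>

text \<open>Greedy descent: the top element is skipped while \<open>\<sigma>\<close> can be reached
  without it, and taken otherwise. The bounds on \<open>\<sigma>\<close> come from the
  \<open>r\<close> smallest and the \<open>r\<close> largest elements.\<close>

lemma ex_subset_with_sum: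
  fixes l n r \<sigma> :: nat
  assumes "l + r \<le> n" "r * (r + 1) + 2 * l * r \<le> 2 * \<sigma>" "2 * \<sigma> + r * r \<le> r * (2 * n + 1)"
  shows "\<exists>E \<subseteq> {l<..n}. card E = r \<and> \<Sum>E = \<sigma>"
  using assms
proof (induction n arbitrary: r \<sigma>)
  case (Suc n)
  show ?case
  proof (cases r)
    case 0
    then show ?thesis using Suc.prems by (intro exI[of _ "{}"]) auto
  next
    case (Suc r')
    show ?thesis
    proof (cases "l + r \<le> n \<and> 2 * \<sigma> + r * r \<le> r * (2 * n + 1)")
      case True
      then obtain E where E: "E \<subseteq> {l<..n}" "card E = r" "\<Sum>E = \<sigma>"
        using Suc.IH[of r \<sigma>] Suc.prems by blast
      then have "E \<subseteq> {l<..Suc n}" by auto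
      then show ?thesis using E by blast
    next
      case False
      obtain s where s: "r * r + r = 2 * s"
        by (metis even_add even_mult_iff evenE)
      have le: "l + r' \<le> n"
        using Suc.prems Suc by simp
      have ub: "\<sigma> + s \<le> r * n + 2 * r"
        using Suc.prems(3) s by (simp add: algebra_simps)
      have lb: "s + l * r \<le> \<sigma>"
        using Suc.prems(2) s by (simp add: algebra_simps)
      \<comment> \<open>After the top element is taken, the rest is still at least the sum of the
        \<open>r'\<close> smallest elements; \<open>s\<close> is the triangular number of
        \<open>r\<close>.\<close>
      have key: "n + s + l * r' + 1 \<le> \<sigma> + r"
      proof (cases "l + r \<le> n")
        case True
        then have "r * n + r + 1 \<le> \<sigma> + s"
          using False s by (auto simp: algebra_simps)
        moreover have "r' * (l + r) \<le> r' * n"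
          using True by simp
        ultimately show ?thesis
          using s Suc by (simp add: algebra_simps)
      next
        case False
        then have "n = l + r'"
          using le Suc by simp
        then show ?thesis
          using lb Suc by (simp add: algebra_simps)
      qed
      have "\<exists>E \<subseteq> {l<..n}. card E = r' \<and> \<Sum>E = \<sigma> - Suc n"
      proof (rule Suc.IH[OF le])
        show "r' * (r' + 1) + 2 * l * r' \<le> 2 * (\<sigma> - Suc n)"
          using key s Suc by (simp add: algebra_simps)
        show "2 * (\<sigma> - Suc n) + r' * r' \<le> r' * (2 * n + 1)"
          using ub key s Suc by (simp add: algebra_simps)
      qed
      then obtain E where E: "E \<subseteq> {l<..n}" "card E = r'" "\<Sum>E = \<sigma> - Suc n" by blast
      have fin: "finite E" "Suc n \<notin> E"
        using E(1) finite_subset by auto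
      have "n < \<sigma>"
        using key s Suc by (simp add: algebra_simps)
      then have "card (insert (Suc n) E) = r" "\<Sum>(insert (Suc n) E) = \<sigma>"
        using E fin Suc by auto
      moreover have "insert (Suc n) E \<subseteq> {l<..Suc n}"
        using E(1) Suc.prems(1) Suc by auto
      ultimately show ?thesis by blast
    qed
  qed
qed (auto intro: exI[of _ "{}"])

text \<open>The sums \<open>i + zigzag N i\<close> form an interval, with its midpoint missing if \<open>N\<close> is even.\<close>

definition zigzag :: "nat \<Rightarrow> nat \<Rightarrow> nat" where
  "zigzag N i = (if even i then (N - 1) div 2 - i div 2 else N - 1 - i div 2)"

lemma zigzag_sum:
  assumes "i < N"
  shows "i + zigzag N i = (if even i then (N - 1) div 2 + i div 2 else N + i div 2)"
proof (cases "even i")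
  case True
  then obtain j where "i = 2 * j" by blast
  then show ?thesis using assms by (simp add: zigzag_def)
next
  case False
  then obtain j where "i = 2 * j + 1" using oddE by blast
  then show ?thesis using assms by (simp add: zigzag_def)
qed

lemma inj_on_zigzag_sum: "inj_on (\<lambda>i. i + zigzag N i) {..<N}"
proof (rule inj_onI)
  fix i j assume ij: "i \<in> {..<N}" "j \<in> {..<N}" "i + zigzag N i = j + zigzag N j"
  have small: "(N - 1) div 2 + k div 2 < N" if "k \<in> {..<N}" for k
    using that by auto
  show "i = j"
    using ij small[of i] small[of j]
    by (auto simp: zigzag_sum split: if_splits) (auto elim!: evenE oddE)
qed

lemma zigzag_less: "i < N \<Longrightarrow> zigzag N i < N"
  by (auto simp: zigzag_def)

lemma inj_on_zigzag: "inj_on (zigzag N) {..<N}"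
proof (rule inj_onI)
  fix i j assume ij: "i \<in> {..<N}" "j \<in> {..<N}" "zigzag N i = zigzag N j"
  then show "i = j"
    by (cases "even i"; cases "even j") (auto simp: zigzag_def elim!: evenE oddE)
qed

lemma zigzag_image: "zigzag N ` {..<N} = {..<N}"
  using zigzag_less inj_on_zigzag by (intro endo_inj_surj) auto

definition admissible :: "nat \<Rightarrow> nat \<Rightarrow> nat \<Rightarrow> nat \<Rightarrow> nat \<Rightarrow> bool" where
  "admissible M lo hi g v \<longleftrightarrow> M < v \<and> (v < lo \<or> hi < v \<or> v = g)"

text \<open>The leftover labels are \<open>{1..n}\<close> and a set \<open>H\<close> of larger ones with sum \<open>h\<close>. The edges at \<open>X\<close> receive \<open>H\<close>
  and \<open>r\<close> elements of \<open>{3..n}\<close> with sum \<open>\<sigma>\<close>; the sums of the paths lie in \<open>{lo..hi} - {g}\<close>, where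
  \<open>g = 0\<close> stands for no gap.\<close>

definition fits :: "nat \<Rightarrow> nat \<Rightarrow> nat \<Rightarrow> nat \<Rightarrow> nat \<Rightarrow> nat \<Rightarrow> nat \<Rightarrow> nat \<Rightarrow> bool" where
  "fits M n h r lo hi g \<sigma> \<longleftrightarrow> 1 \<le> r \<and> r + 2 \<le> n \<and> r * (r + 5) \<le> 2 * \<sigma> \<and> 2 * \<sigma> + r * r \<le> r * (2 * n + 1) \<and>
     admissible M lo hi g (h + \<sigma>) \<and> admissible M lo hi g (n * (n + 1) div 2 - \<sigma>) \<and>
     n * (n + 1) div 2 - \<sigma> \<noteq> h + \<sigma>"

text \<open>The smallest element \<open>k\<close> of the chosen set becomes the label of
  \<open>XY\<close>. As the labels 1 and 2 are excluded from the choice, \<open>1\<close> and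
  \<open>k - 1\<close> are distinct labels outside it with sum \<open>k\<close>, so any set of the
  right size and sum will do. The sum of \<open>H\<close> cancels at \<open>Y\<close>, which leaves
  \<open>n * (n + 1) div 2 - \<sigma>\<close> there.\<close>

lemma antimagic_fits:
  fixes p q :: "nat \<Rightarrow> nat"
  assumes I: "finite I" "card I + 1 = c" and M: "M = a + b + 1 + 2 * c"
    and pq: "inj_on p I" "inj_on q I" "p ` I \<inter> q ` I = {}" "p ` I \<union> q ` I = {n<..M} - H"
    and H: "H \<subseteq> {n<..M}" "card H + r = a + 1" "n \<le> M"
    and inj: "inj_on (\<lambda>t. p t + q t) I"
    and window: "\<And>t. t \<in> I \<Longrightarrow> lo \<le> p t + q t \<and> p t + q t \<le> hi \<and> p t + q t \<noteq> g" "M < lo"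
    and fits: "fits M n (\<Sum>H) r lo hi g \<sigma>"
  shows "antimagic (star_paths a b c)"
proof -
  define T where "T = n * (n + 1) div 2"
  have T: "\<Sum>{1..n} = T"
    using twice_sum_atLeastAtMost_1[of n] by (simp add: T_def)
  have \<sigma>: "1 \<le> r" "r + 2 \<le> n" "r * (r + 5) \<le> 2 * \<sigma>" "2 * \<sigma> + r * r \<le> r * (2 * n + 1)"
    "admissible M lo hi g (\<Sum>H + \<sigma>)" "admissible M lo hi g (T - \<sigma>)" "T - \<sigma> \<noteq> \<Sum>H + \<sigma>"
    using fits by (simp_all add: fits_def T_def)
  have "\<exists>E \<subseteq> {2<..n}. card E = r \<and> \<Sum>E = \<sigma>"
    using \<sigma> by (intro ex_subset_with_sum) (simp_all add: algebra_simps)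
  then obtain E where E: "E \<subseteq> {2<..n}" "card E = r" "\<Sum>E = \<sigma>" by blast
  have fin: "finite E" "finite H"
    using E(1) H(1) finite_subset by auto
  define k where "k = Min E"
  have "E \<noteq> {}"
    using E(2) \<sigma>(1) by auto
  then have k: "k \<in> E" "\<And>x. x \<in> E \<Longrightarrow> k \<le> x"
    using fin by (auto simp: k_def)
  have k3: "3 \<le> k" "k \<le> n"
    using k(1) E(1) by auto
  have disj: "H \<inter> E = {}" "{1..n} \<inter> H = {}"
    using H(1) E(1) by fastforce+
  have sum: "\<Sum>(H \<union> E) = \<Sum>H + \<sigma>" "\<Sum>({1..n} \<union> H) = T + \<Sum>H"
    using disj fin E(3) T by (simp_all add: sum.union_disjoint)
  show ?thesis
  proof (rule antimagic_sufficient[OF I M pq(1,2,3), of "{1..n} \<union> H" "H \<union> E" k 1 "k - 1"])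
    show "({1..n} \<union> H) \<inter> (p ` I \<union> q ` I) = {}" "({1..n} \<union> H) \<union> (p ` I \<union> q ` I) = {1..M}"
      unfolding pq(4) using H(1,3) by auto
    show "H \<union> E \<subseteq> {1..n} \<union> H" using E(1) by auto
    show "card (H \<union> E) = a + 1"
      using disj fin E(2) H(2) by (simp add: card_Un_disjoint)
    show "k \<in> H \<union> E" using k by simp
    have "1 \<notin> H" "k - 1 \<notin> H"
      using H(1) k3 by fastforce+
    moreover have "1 \<notin> E" "k - 1 \<notin> E"
      using E(1) k(2)[of "k - 1"] k3 by auto
    ultimately show "1 \<in> {1..n} \<union> H - (H \<union> E)" "k - 1 \<in> {1..n} \<union> H - (H \<union> E)"
      using k3 by auto
    show "1 \<noteq> k - 1" "1 + (k - 1) = k" using k3 by auto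
    fix t assume "t \<in> I"
    then show "M < p t + q t" "p t + q t \<noteq> \<Sum>(H \<union> E)" "p t + q t + \<Sum>(H \<union> E) \<noteq> \<Sum>({1..n} \<union> H)"
      using window \<sigma>(5,6) unfolding sum admissible_def by force+
  next
    have *: "M < \<Sum>H + \<sigma>" "M < T - \<sigma>"
      using \<sigma>(5,6) by (simp_all add: admissible_def)
    then show "M < \<Sum>(H \<union> E)" "M + \<Sum>(H \<union> E) < \<Sum>({1..n} \<union> H)"
      unfolding sum by linarith+
    show "2 * \<Sum>(H \<union> E) \<noteq> \<Sum>({1..n} \<union> H)"
    proof
      assume "2 * \<Sum>(H \<union> E) = \<Sum>({1..n} \<union> H)"
      then have "T = \<Sum>H + 2 * \<sigma>"
        unfolding sum by simp
      then show False using \<sigma>(7) by simp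
    qed
  qed (rule inj)
qed

lemma inj_on_add_const: "inj_on (\<lambda>i. k + f i) S \<longleftrightarrow> inj_on f S" for k :: nat
  by (auto simp: inj_on_def)

lemma image_add_lessThan: "(\<lambda>i. k + i) ` {..<N} = {k..<k + N}" for k :: nat
  using image_add_atLeastLessThan[of k 0 N] by (simp add: lessThan_atLeast0 add.commute)

lemma image_add_zigzag: "(\<lambda>i. k + zigzag N i) ` {..<N} = {k..<k + N}" for k :: nat
  using zigzag_image[of N] image_add_lessThan[of k N] by (metis image_image)

lemma inj_on_zigzag_shift:
  assumes "I \<subseteq> {..<N}"
  shows "inj_on (\<lambda>i. k + i) I" "inj_on (\<lambda>i. k + zigzag N i) I"
    "inj_on (\<lambda>i. (k + i) + (k' + zigzag N i)) I"
proof -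
  have "(\<lambda>i. (k + i) + (k' + zigzag N i)) = (\<lambda>i. (k + k') + (i + zigzag N i))"
    by (simp add: fun_eq_iff)
  then show "inj_on (\<lambda>i. (k + i) + (k' + zigzag N i)) I"
    using inj_on_subset[OF inj_on_zigzag_sum assms] by (simp only: inj_on_add_const)
qed (use inj_on_subset[OF inj_on_zigzag assms] in \<open>simp_all only: inj_on_add_const, simp_all\<close>)

lemma zigzag_sum_odd:
  assumes "N = 2 * u + 1" "i < N"
  shows "u \<le> i + zigzag N i" "i + zigzag N i \<le> 3 * u"
  using zigzag_sum[of i N] assms by (auto elim!: evenE oddE)

text \<open>The gap is unavoidable: for a permutation \<open>\<pi>\<close> of \<open>{..<N}\<close>
  the sums \<open>i + \<pi> i\<close> have mean \<open>N - 1\<close>, whereas an interval of evenly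
  many integers has a half-integral mean. The \<open>+ 1\<close> avoids a truncated
  \<open>u - 1\<close>.\<close>

lemma zigzag_sum_even:
  assumes "N = 2 * u" "i < N"
  shows "u \<le> i + zigzag N i + 1" "i + zigzag N i + 1 \<le> 3 * u" "i + zigzag N i + 1 \<noteq> 2 * u"
proof -
  have "(N - 1) div 2 = u - 1"
    using assms(1) by (cases u) auto
  then show "u \<le> i + zigzag N i + 1" "i + zigzag N i + 1 \<le> 3 * u" "i + zigzag N i + 1 \<noteq> 2 * u"
    using zigzag_sum[of i N] assms by (auto elim!: evenE oddE)
qed

lemma zigzag_sum_neq:
  "i < N \<Longrightarrow> j < N \<Longrightarrow> i \<noteq> j \<Longrightarrow> i + zigzag N i \<noteq> j + zigzag N j"
  using inj_onD[OF inj_on_zigzag_sum, of i N j] by auto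

lemma zigzag_image_diff:
  "j < N \<Longrightarrow> (\<lambda>i. k + zigzag N i) ` ({..<N} - {j}) = {k..<k + N} - {k + zigzag N j}" for k :: nat
  using inj_on_image_set_diff[of "\<lambda>i. k + zigzag N i" "{..<N}" "{..<N}" "{j}"]
    inj_on_zigzag_shift(2)[OF subset_refl]
  by (simp add: image_add_zigzag)

lemma image_add_diff_0:
  "0 < N \<Longrightarrow> (\<lambda>i. k + i) ` ({..<N} - {0}) = {k<..<k + N}" for k :: nat
  using inj_on_image_set_diff[of "\<lambda>i. k + i" "{..<N}" "{..<N}" "{0}"]
    inj_on_zigzag_shift(1)[OF subset_refl]
  by (auto simp: image_add_lessThan)

section \<open>Six zigzag labelings, by the parity of \<open>c\<close> and the pair removed\<close>

context
  fixes a b c m M t :: nat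
  assumes m: "m = a + b + 1" and M: "M = m + 2 * c"
begin

text \<open>No large label is left over: a zigzag of length \<open>c - 1\<close> covers everything
  above \<open>m + 2\<close>. The upper bound on \<open>t\<close> says precisely that the window
  starts above \<open>M\<close>; it allows \<open>c = 2 * m + 6\<close>.\<close>

lemma antimagic_low_even:
  assumes c: "c = 2 * t" "1 \<le> t" "t \<le> m + 3"
    and fits: "fits M (m + 2) 0 (a + 1) (2 * m + 3 * t + 4) (2 * m + 5 * t + 2) 0 \<sigma>"
  shows "antimagic (star_paths a b c)"
proof (rule antimagic_fits)
  let ?p = "\<lambda>i. (m + 3) + i" and ?q = "\<lambda>i. (m + c + 2) + zigzag (c - 1) i" and ?I = "{..<c - 1}"
  show "inj_on ?p ?I" "inj_on ?q ?I" "inj_on (\<lambda>i. ?p i + ?q i) ?I"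
    by (rule inj_on_zigzag_shift[OF subset_refl])+
  show "?p ` ?I \<inter> ?q ` ?I = {}" "?p ` ?I \<union> ?q ` ?I = {m + 2<..M} - {}"
    unfolding image_add_lessThan image_add_zigzag using c M by auto
  show "fits M (m + 2) (\<Sum>{}) (a + 1) (2 * m + 3 * t + 4) (2 * m + 5 * t + 2) 0 \<sigma>"
    using fits by simp
  have N: "c - 1 = 2 * (t - 1) + 1"
    using c by (cases t) auto
  fix i assume "i \<in> ?I"
  then show "2 * m + 3 * t + 4 \<le> ?p i + ?q i \<and> ?p i + ?q i \<le> 2 * m + 5 * t + 2 \<and> ?p i + ?q i \<noteq> 0"
    using zigzag_sum_odd[OF N, of i] c by auto
qed (use c m M in auto)

lemma antimagic_low_odd:
  assumes c: "c = 2 * t + 1" "t \<le> m + 2"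
    and fits: "fits M (m + 2) 0 (a + 1) (2 * m + 3 * t + 5) (2 * m + 5 * t + 5) (2 * m + 4 * t + 5) \<sigma>"
  shows "antimagic (star_paths a b c)"
proof (rule antimagic_fits)
  let ?p = "\<lambda>i. (m + 3) + i" and ?q = "\<lambda>i. (m + c + 2) + zigzag (c - 1) i" and ?I = "{..<c - 1}"
  show "inj_on ?p ?I" "inj_on ?q ?I" "inj_on (\<lambda>i. ?p i + ?q i) ?I"
    by (rule inj_on_zigzag_shift[OF subset_refl])+
  show "?p ` ?I \<inter> ?q ` ?I = {}" "?p ` ?I \<union> ?q ` ?I = {m + 2<..M} - {}"
    unfolding image_add_lessThan image_add_zigzag using c M by auto
  show "fits M (m + 2) (\<Sum>{}) (a + 1) (2 * m + 3 * t + 5) (2 * m + 5 * t + 5) (2 * m + 4 * t + 5) \<sigma>"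
    using fits by simp
  fix i assume "i \<in> ?I"
  then show "2 * m + 3 * t + 5 \<le> ?p i + ?q i \<and> ?p i + ?q i \<le> 2 * m + 5 * t + 5 \<and> ?p i + ?q i \<noteq> 2 * m + 4 * t + 5"
    using zigzag_sum_even[of "c - 1" t i] c by auto
qed (use c m M in auto)

text \<open>In the next two lemmas the label \<open>m + c + 1\<close> occurs in the zigzag both as the last of the smaller
  and as the first of the larger labels; dropping the last pair removes the repetition.\<close>

lemma antimagic_last_even:
  assumes c: "c = 2 * t" "1 \<le> t" "t \<le> m + 1"
    and fits: "fits M (m + 1) (m + 3 * t + 1) a (2 * m + 3 * t + 2) (2 * m + 5 * t + 1) (2 * m + 4 * t + 2) \<sigma>"
  shows "antimagic (star_paths a b c)"
proof (rule antimagic_fits)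
  let ?p = "\<lambda>i. (m + 2) + i" and ?q = "\<lambda>i. (m + c + 1) + zigzag c i" and ?I = "{..<c} - {c - 1}"
  have I: "?I \<subseteq> {..<c}" "?I = {..<c - 1}" by auto
  \<comment> \<open>The dropped pair has the largest sum, so \<open>hi\<close> decreases and the gap
    stays; its larger label \<open>m + 3 * t + 1\<close> is freed.\<close>
  have z: "zigzag c (c - 1) = t"
    using zigzag_sum[of "c - 1" c] c by (cases t) auto
  show "inj_on ?p ?I" "inj_on ?q ?I" "inj_on (\<lambda>i. ?p i + ?q i) ?I"
    by (rule inj_on_zigzag_shift[OF I(1)])+
  have p: "?p ` ?I = {m + 2..<m + c + 1}"
    using image_add_lessThan[of "m + 2" "c - 1"] c unfolding I(2) by simp
  have q: "?q ` ?I = {m + c + 1..<m + c + 1 + c} - {m + 3 * t + 1}"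
    using zigzag_image_diff[of "c - 1" c "m + c + 1"] c unfolding z by (simp add: algebra_simps)
  show "?p ` ?I \<inter> ?q ` ?I = {}" "?p ` ?I \<union> ?q ` ?I = {m + 1<..M} - {m + 3 * t + 1}"
    unfolding p q using c M by auto
  show "fits M (m + 1) (\<Sum>{m + 3 * t + 1}) a (2 * m + 3 * t + 2) (2 * m + 5 * t + 1) (2 * m + 4 * t + 2) \<sigma>"
    using fits by simp
  fix i assume "i \<in> ?I"
  then show "2 * m + 3 * t + 2 \<le> ?p i + ?q i \<and> ?p i + ?q i \<le> 2 * m + 5 * t + 1 \<and> ?p i + ?q i \<noteq> 2 * m + 4 * t + 2"
    using zigzag_sum_even[of c t i] zigzag_sum_neq[of i c "c - 1"] c unfolding z by auto
qed (use c m M in auto)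

lemma antimagic_last_odd:
  assumes c: "c = 2 * t + 1" "t \<le> m + 1"
    and fits: "fits M (m + 1) (m + 2 * t + 2) a (2 * m + 3 * t + 4) (2 * m + 5 * t + 4) (2 * m + 4 * t + 4) \<sigma>"
  shows "antimagic (star_paths a b c)"
proof (rule antimagic_fits)
  let ?p = "\<lambda>i. (m + 2) + i" and ?q = "\<lambda>i. (m + c + 1) + zigzag c i" and ?I = "{..<c} - {c - 1}"
  have I: "?I \<subseteq> {..<c}" "?I = {..<c - 1}" by auto
  \<comment> \<open>Both labels of the dropped pair are \<open>m + c + 1\<close>. Its sum is the
    middle one, which opens a gap there.\<close>
  have z: "zigzag c (c - 1) = 0"
    using zigzag_sum[of "c - 1" c] c by auto
  show "inj_on ?p ?I" "inj_on ?q ?I" "inj_on (\<lambda>i. ?p i + ?q i) ?I"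
    by (rule inj_on_zigzag_shift[OF I(1)])+
  have p: "?p ` ?I = {m + 2..<m + c + 1}"
    using image_add_lessThan[of "m + 2" "c - 1"] c unfolding I(2) by simp
  have q: "?q ` ?I = {m + c + 1..<m + c + 1 + c} - {m + 2 * t + 2}"
    using zigzag_image_diff[of "c - 1" c "m + c + 1"] c unfolding z by (simp add: algebra_simps)
  show "?p ` ?I \<inter> ?q ` ?I = {}" "?p ` ?I \<union> ?q ` ?I = {m + 1<..M} - {m + 2 * t + 2}"
    unfolding p q using c M by auto
  show "fits M (m + 1) (\<Sum>{m + 2 * t + 2}) a (2 * m + 3 * t + 4) (2 * m + 5 * t + 4) (2 * m + 4 * t + 4) \<sigma>"
    using fits by simp
  fix i assume "i \<in> ?I"
  then show "2 * m + 3 * t + 4 \<le> ?p i + ?q i \<and> ?p i + ?q i \<le> 2 * m + 5 * t + 4 \<and> ?p i + ?q i \<noteq> 2 * m + 4 * t + 4"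
    using zigzag_sum_odd[of c t i] zigzag_sum_neq[of i c "c - 1"] c unfolding z by auto
qed (use c m M in auto)

text \<open>Here the smaller labels of the zigzag begin with \<open>m + 1\<close>, which already
  belongs to \<open>{1..m + 1}\<close>. Dropping the first pair removes the overlap, frees its
  larger label for \<open>X\<close> and deletes the least path sum.\<close>

lemma antimagic_first_even:
  assumes c: "c = 2 * t" "1 \<le> t" "t \<le> m + 1"
    and fits: "fits M (m + 1) (m + 3 * t) a (2 * m + 3 * t + 2) (2 * m + 5 * t + 1) (2 * m + 4 * t + 1) \<sigma>"
  shows "antimagic (star_paths a b c)"
proof (rule antimagic_fits)
  let ?p = "\<lambda>i. (m + 1) + i" and ?q = "\<lambda>i. (m + c + 1) + zigzag c i" and ?I = "{..<c} - {0}"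
  have I: "?I \<subseteq> {..<c}" by auto
  have z: "zigzag c 0 = t - 1"
    using zigzag_sum[of 0 c] c by (cases t) auto
  show "inj_on ?p ?I" "inj_on ?q ?I" "inj_on (\<lambda>i. ?p i + ?q i) ?I"
    by (rule inj_on_zigzag_shift[OF I])+
  have p: "?p ` ?I = {m + 1<..<m + 1 + c}"
    using c by (intro image_add_diff_0) simp
  have q: "?q ` ?I = {m + c + 1..<m + c + 1 + c} - {m + 3 * t}"
    using zigzag_image_diff[of 0 c "m + c + 1"] c unfolding z by (simp add: algebra_simps)
  show "?p ` ?I \<inter> ?q ` ?I = {}" "?p ` ?I \<union> ?q ` ?I = {m + 1<..M} - {m + 3 * t}"
    unfolding p q using c M by auto
  show "fits M (m + 1) (\<Sum>{m + 3 * t}) a (2 * m + 3 * t + 2) (2 * m + 5 * t + 1) (2 * m + 4 * t + 1) \<sigma>"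
    using fits by simp
  fix i assume "i \<in> ?I"
  then show "2 * m + 3 * t + 2 \<le> ?p i + ?q i \<and> ?p i + ?q i \<le> 2 * m + 5 * t + 1 \<and> ?p i + ?q i \<noteq> 2 * m + 4 * t + 1"
    using zigzag_sum_even[of c t i] zigzag_sum_neq[of i c 0] c unfolding z by auto
qed (use c m M in auto)

lemma antimagic_first_odd:
  assumes c: "c = 2 * t + 1" "t \<le> m + 1"
    and fits: "fits M (m + 1) (m + 3 * t + 2) a (2 * m + 3 * t + 4) (2 * m + 5 * t + 3) 0 \<sigma>"
  shows "antimagic (star_paths a b c)"
proof (rule antimagic_fits)
  let ?p = "\<lambda>i. (m + 1) + i" and ?q = "\<lambda>i. (m + c + 1) + zigzag c i" and ?I = "{..<c} - {0}"
  have I: "?I \<subseteq> {..<c}" by auto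
  have z: "zigzag c 0 = t"
    using zigzag_sum[of 0 c] c by auto
  show "inj_on ?p ?I" "inj_on ?q ?I" "inj_on (\<lambda>i. ?p i + ?q i) ?I"
    by (rule inj_on_zigzag_shift[OF I])+
  have p: "?p ` ?I = {m + 1<..<m + 1 + c}"
    using c by (intro image_add_diff_0) simp
  have q: "?q ` ?I = {m + c + 1..<m + c + 1 + c} - {m + 3 * t + 2}"
    using zigzag_image_diff[of 0 c "m + c + 1"] c unfolding z by (simp add: algebra_simps)
  show "?p ` ?I \<inter> ?q ` ?I = {}" "?p ` ?I \<union> ?q ` ?I = {m + 1<..M} - {m + 3 * t + 2}"
    unfolding p q using c M by auto
  show "fits M (m + 1) (\<Sum>{m + 3 * t + 2}) a (2 * m + 3 * t + 4) (2 * m + 5 * t + 3) 0 \<sigma>"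
    using fits by simp
  fix i assume "i \<in> ?I"
  then show "2 * m + 3 * t + 4 \<le> ?p i + ?q i \<and> ?p i + ?q i \<le> 2 * m + 5 * t + 3 \<and> ?p i + ?q i \<noteq> 0"
    using zigzag_sum_odd[of c t i] zigzag_sum_neq[of i c 0] c unfolding z by auto
qed (use c m M in auto)

end

subsection \<open>The case of at least 26 edges in the double star\<close>

text \<open>Lets the quadratic total \<open>T\<close> be treated as an opaque constant with a linear
  lower bound, so that linear arithmetic suffices below.\<close>

lemma le_triangle:
  fixes k n :: nat
  assumes "k \<le> n"
  shows "k * (n + 1) \<le> 2 * (n * (n + 1) div 2)"
proof -
  have "k * (n + 1) \<le> n * (n + 1)"
    using assms by (rule mult_le_mono1)
  also have "\<dots> = 2 * (n * (n + 1) div 2)"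
    by (rule dvd_mult_div_cancel[symmetric]) simp
  finally show ?thesis .
qed

text \<open>In every case the sum at \<open>Y\<close> lies above all path sums, and
  \<open>\<sigma>\<close> steers the sum at \<open>X\<close> to a hole: just below the window, in
  its gap, or above it.\<close>

lemma antimagic_small_a:
  assumes a: "1 \<le> a" "a \<le> 7" "a = 7 \<Longrightarrow> c = 2 * m + 6 \<Longrightarrow> 30 \<le> m"
    and m: "m = a + b + 1" "26 \<le> m"
    and c: "1 \<le> c" "c \<le> 2 * m + max 2 a - 1"
  shows "antimagic (star_paths a b c)"
proof -
  define T where "T = (m + 1) * (m + 1 + 1) div 2"
  define T' where "T' = (m + 2) * (m + 2 + 1) div 2"
  have T: "(m + 1) * (m + 1 + 1) div 2 = T" "27 * (m + 1 + 1) \<le> 2 * T"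
    unfolding T_def by (rule refl, rule le_triangle) (use m(2) in simp)
  have T': "(m + 2) * (m + 2 + 1) div 2 = T'" "28 * (m + 2 + 1) \<le> 2 * T'"
    unfolding T'_def by (rule refl, rule le_triangle) (use m(2) in simp)
  note fits_T = fits_def[of _ "m + 1", unfolded T(1)] fits_def[of _ "m + 2", unfolded T'(1)] admissible_def
  have a_cases: "a = 1 \<or> a = 2 \<or> a = 3 \<or> a = 4 \<or> a = 5 \<or> a = 6 \<or> a = 7"
    using a(1,2) by linarith
  consider (odd) t where "c = 2 * t + 1" "t \<le> m" | (even) t where "c = 2 * t" "1 \<le> t" "t \<le> m"
    | (2) "c = 2 * m + 2" "3 \<le> a" | (3) "c = 2 * m + 3" "4 \<le> a" | (4) "c = 2 * m + 4" "5 \<le> a"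
    | (5) "c = 2 * m + 5" "6 \<le> a" | (6) "c = 2 * m + 6" "a = 7"
  proof -
    have "c \<le> 2 * m + 1 \<or> c = 2 * m + 2 \<and> 3 \<le> a \<or> c = 2 * m + 3 \<and> 4 \<le> a \<or> c = 2 * m + 4 \<and> 5 \<le> a
       \<or> c = 2 * m + 5 \<and> 6 \<le> a \<or> c = 2 * m + 6 \<and> a = 7"
      using c a(1,2) by auto
    moreover have thesis if "c \<le> 2 * m + 1"
      using that c(1) odd even by (cases "even c") (auto elim!: evenE oddE)
    ultimately show thesis
      using 2 3 4 5 6 by blast
  qed
  then show ?thesis
  proof cases
    case odd
    \<comment> \<open>For \<open>a \<le> 3\<close> the sum at \<open>X\<close> is
      \<open>lo - 1\<close>. For \<open>a \<ge> 4\<close> it exceeds \<open>hi\<close>; the constant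
      20 makes \<open>\<sigma>\<close> large enough for seven labels and keeps it small enough for
      four. The next case is alike.\<close>
    show ?thesis
      by (rule antimagic_first_odd[OF m(1) refl odd(1), of "if a \<le> 3 then m + 1 else m + 2 * t + 20"])
        (unfold fits_T, use a_cases odd m(2) T(2) in auto)
  next
    case even
    show ?thesis
      by (rule antimagic_last_even[OF m(1) refl even(1), of "if a \<le> 3 then m else m + 2 * t + 20"])
        (unfold fits_T, use a_cases even m(2) T(2) in auto)
  next
    case 2
    \<comment> \<open>With \<open>t = m + 1\<close> the gap is \<open>6 * m + 6\<close>, and the sum
      at \<open>X\<close> hits it. The gap is also the target for \<open>c = 2 * m + 3\<close> and
      \<open>c = 2 * m + 5\<close>.\<close>
    show ?thesis
      by (rule antimagic_last_even[OF m(1) refl, of c "m + 1" "2 * m + 2"])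
        (unfold fits_T, use a_cases 2 m(2) T(2) in auto)
  next
    case 3
    show ?thesis
      by (rule antimagic_last_odd[OF m(1) refl, of c "m + 1" "3 * m + 4"])
        (unfold fits_T, use a_cases 3 m(2) T(2) in auto)
  next
    case 4
    \<comment> \<open>The path sums start at \<open>M + 2\<close>, and the sum at \<open>X\<close>
      is \<open>M + 1\<close>.\<close>
    show ?thesis
      by (rule antimagic_low_even[OF m(1) refl, of c "m + 2" "5 * m + 9"])
        (unfold fits_T, use a_cases 4 m(2) T'(2) in auto)
  next
    case 5
    show ?thesis
      by (rule antimagic_low_odd[OF m(1) refl, of c "m + 2" "6 * m + 13"])
        (unfold fits_T, use a_cases 5 m(2) T'(2) in auto)
  next
    case 6
    \<comment> \<open>The target is \<open>hi + 1 = 7 * m + 18\<close>. Eight labels up to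
      \<open>m + 2\<close> have sum at most \<open>8 * m - 12\<close>, which is enough exactly from
      \<open>m = 30\<close> on.\<close>
    show ?thesis
      by (rule antimagic_low_even[OF m(1) refl, of c "m + 3" "7 * m + 18"])
        (unfold fits_T, use 6 a(3) m(2) T'(2) in auto)
  qed
qed

text \<open>All path sums are at most \<open>7 * m + 17\<close>, and the
  \<open>a + 1 \<ge> 9\<close> labels at \<open>X\<close> can exceed this without a large one among
  them. The sum at \<open>Y\<close> is then larger still, where \<open>a \<le> b\<close> is needed
  if \<open>a\<close> is large.\<close>

lemma antimagic_large_a:
  assumes a: "8 \<le> a" "a \<le> b" and m: "m = a + b + 1" "26 \<le> m"
    and c: "1 \<le> c" "c \<le> 2 * m + 6"
  shows "antimagic (star_paths a b c)"
proof -
  define T where "T = (m + 2) * (m + 2 + 1) div 2"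
  have T: "(m + 2) * (m + 2 + 1) div 2 = T" "28 * (m + 2 + 1) \<le> 2 * T"
    unfolding T_def by (rule refl, rule le_triangle) (use m(2) in simp)
  have T2: "2 * T = (m + 2) * (m + 2 + 1)"
    unfolding T_def by (rule dvd_mult_div_cancel) simp
  \<comment> \<open>The least sum of \<open>a + 1\<close> labels from 3 on.\<close>
  define \<mu> where "\<mu> = (a + 1) * (a + 6) div 2"
  have \<mu>: "(a + 1) * (a + 6) = 2 * \<mu>"
    unfolding \<mu>_def by (rule dvd_mult_div_cancel[symmetric]) simp
  have *: "\<exists>\<sigma>. fits M (m + 2) 0 (a + 1) lo hi g \<sigma>" if hi: "M \<le> hi" "hi \<le> 7 * m + 17" for M lo hi g
  proof (intro exI)
    define \<sigma> where "\<sigma> = max (hi + 1) \<mu>"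
    obtain d where d: "a = 8 + d"
      using a(1) le_Suc_ex by blast
    obtain e where e: "b = a + e"
      using a(2) le_Suc_ex by blast
    have ub: "2 * \<sigma> + (a + 1) * (a + 1) \<le> (a + 1) * (2 * (m + 2) + 1)"
    proof (cases "hi + 1 \<le> \<mu>")
      case True
      have "2 * \<mu> + (a + 1) * (a + 1) \<le> (a + 1) * (2 * (m + 2) + 1)"
        unfolding \<mu>[symmetric] m(1) e by (simp add: algebra_simps)
      then show ?thesis using True by (simp add: \<sigma>_def)
    next
      case False
      have "2 * (7 * m + 18) + (a + 1) * (a + 1) \<le> (a + 1) * (2 * (m + 2) + 1)"
        using m(2) unfolding m(1) e d by (simp add: algebra_simps)
      then show ?thesis using False hi by (simp add: \<sigma>_def)
    qed
    have "4 * \<mu> + 1 \<le> 2 * T"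
      using \<mu> T2 unfolding m(1) e d by (simp add: algebra_simps)
    \<comment> \<open>For the largest \<open>hi\<close> this requires
      \<open>2 * (7 * m + 18) < T\<close>, which holds from \<open>m = 26\<close> on and fails for
      \<open>m = 25\<close>.\<close>
    then have "2 * \<sigma> < T"
      using hi T(2) m(2) by (simp add: \<sigma>_def max_def)
    moreover have "hi < \<sigma>" "\<mu> \<le> \<sigma>"
      by (simp_all add: \<sigma>_def)
    moreover from this have "(a + 1) * (a + 1 + 5) \<le> 2 * \<sigma>"
      using \<mu> by (simp add: algebra_simps)
    ultimately show "fits M (m + 2) 0 (a + 1) lo hi g \<sigma>"
      unfolding fits_def admissible_def T using ub hi(1) m(1) a by auto
  qed
  show ?thesis
  proof (cases "even c")
    case True
    then obtain t where t: "c = 2 * t" by blast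
    obtain \<sigma> where "fits (m + 2 * c) (m + 2) 0 (a + 1) (2 * m + 3 * t + 4) (2 * m + 5 * t + 2) 0 \<sigma>"
      using *[of "m + 2 * c" "2 * m + 5 * t + 2"] t c by auto
    then show ?thesis
      using antimagic_low_even[OF m(1) refl t] t c by auto
  next
    case False
    then obtain t where t: "c = 2 * t + 1" using oddE by blast
    obtain \<sigma> where "fits (m + 2 * c) (m + 2) 0 (a + 1) (2 * m + 3 * t + 5) (2 * m + 5 * t + 5) (2 * m + 4 * t + 5) \<sigma>"
      using *[of "m + 2 * c" "2 * m + 5 * t + 5"] t c by auto
    then show ?thesis
      using antimagic_low_odd[OF m(1) refl t] t c by auto
  qed
qed

subsection \<open>The case of at most 25 edges in the double star\<close>

text \<open>The simplifier evaluates both sides of a disjunction, but only the relevant branch of a conditional.\<close>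

primrec search :: "('a \<Rightarrow> bool) \<Rightarrow> 'a list \<Rightarrow> bool" where
  "search P [] \<longleftrightarrow> False"
| "search P (x # xs) \<longleftrightarrow> (if P x then True else search P xs)"

lemma search_iff: "search P xs \<longleftrightarrow> (\<exists>x\<in>set xs. P x)"
  by (induction xs) auto

lemma if_True_else: "(if P then True else Q) \<longleftrightarrow> P \<or> Q"
  by simp

text \<open>Only extreme candidates for \<open>\<sigma>\<close> are tried: the largest one, and
  those that put the sum at \<open>X\<close> or \<open>Y\<close> at \<open>M + 1\<close>, at
  \<open>lo - 1\<close> or in the gap, or the sum at \<open>Y\<close> at \<open>hi + 1\<close>.
  Truncated differences do no harm, as \<open>fits\<close> checks each candidate.\<close>

definition fits_some :: "nat \<Rightarrow> nat \<Rightarrow> nat \<Rightarrow> nat \<Rightarrow> nat \<Rightarrow> nat \<Rightarrow> nat \<Rightarrow> bool" where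
  "fits_some M n h r lo hi g \<longleftrightarrow>
     (let T = n * (n + 1) div 2 in
      search (fits M n h r lo hi g)
        [r * n - r * (r - 1) div 2, T - (hi + 1), T - (M + 1), T - g, T + 1 - lo, M + 1 - h, lo - (h + 1), g - h])"

definition zigzag_fits :: "nat \<Rightarrow> nat \<Rightarrow> nat \<Rightarrow> bool" where
  "zigzag_fits m a c \<longleftrightarrow>
    (let t = c div 2; M = m + 2 * c in
     if even c then
       if t \<le> m + 1 \<and> fits_some M (m + 1) (m + 3 * t) a (2 * m + 3 * t + 2) (2 * m + 5 * t + 1) (2 * m + 4 * t + 1) then True
       else if t \<le> m + 1 \<and> fits_some M (m + 1) (m + 3 * t + 1) a (2 * m + 3 * t + 2) (2 * m + 5 * t + 1) (2 * m + 4 * t + 2) then True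
       else t \<le> m + 3 \<and> fits_some M (m + 2) 0 (a + 1) (2 * m + 3 * t + 4) (2 * m + 5 * t + 2) 0
     else
       if t \<le> m + 1 \<and> fits_some M (m + 1) (m + 3 * t + 2) a (2 * m + 3 * t + 4) (2 * m + 5 * t + 3) 0 then True
       else if t \<le> m + 1 \<and> fits_some M (m + 1) (m + 2 * t + 2) a (2 * m + 3 * t + 4) (2 * m + 5 * t + 4) (2 * m + 4 * t + 4) then True
       else t \<le> m + 2 \<and> fits_some M (m + 2) 0 (a + 1) (2 * m + 3 * t + 5) (2 * m + 5 * t + 5) (2 * m + 4 * t + 5))"

lemma fits_someD: "fits_some M n h r lo hi g \<Longrightarrow> \<exists>\<sigma>. fits M n h r lo hi g \<sigma>"
  by (auto simp: fits_some_def search_iff Let_def)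

lemma antimagic_zigzag_fits:
  assumes m: "m = a + b + 1" and "1 \<le> c" "zigzag_fits m a c"
  shows "antimagic (star_paths a b c)"
proof (cases "even c")
  case True
  then obtain t where t: "c = 2 * t" by blast
  then have t': "1 \<le> t" "c div 2 = t" using assms(2) by simp_all
  note rules = antimagic_first_even[OF m refl t t'(1)] antimagic_last_even[OF m refl t t'(1)]
    antimagic_low_even[OF m refl t t'(1)]
  show ?thesis
    using assms(3) unfolding zigzag_fits_def Let_def t'(2) if_P[OF True] if_True_else
    by (elim disjE conjE) (drule fits_someD, elim exE, rule rules, assumption, assumption)+
next
  case False
  then obtain t where t: "c = 2 * t + 1" using oddE by blast
  then have t': "c div 2 = t" by simp
  note rules = antimagic_first_odd[OF m refl t] antimagic_last_odd[OF m refl t] antimagic_low_odd[OF m refl t]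
  show ?thesis
    using assms(3) unfolding zigzag_fits_def Let_def t' if_not_P[OF False] if_True_else
    by (elim disjE conjE) (drule fits_someD, elim exE, rule rules, assumption, assumption)+
qed

text \<open>A certificate consists of \<open>m\<close>, the pairs of labels of all paths but one, and, for each \<open>a\<close> it serves, a
  label \<open>i\<close> and the list \<open>k # A\<close> of the labels at \<open>X\<close>, beginning with the label \<open>k\<close> of \<open>XY\<close>. The remaining path
  receives \<open>i\<close> and \<open>k - i\<close>.\<close>

definition valid_certificate :: "nat \<times> (nat \<times> nat) list \<times> (nat \<times> nat list) list \<Rightarrow> bool" where
  "valid_certificate = (\<lambda>(m, ps, Es).
     let M = m + 2 * (length ps + 1); L = map fst ps @ map snd ps; S = map (\<lambda>(x, y). x + y) ps;
         T = M * (M + 1) div 2 - sum_list L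
     in distinct L \<and> distinct S \<and> list_all (\<lambda>x. 1 \<le> x \<and> x \<le> M) L \<and> list_all (\<lambda>s. M < s) S \<and>
        list_all (\<lambda>(i, E). let k = hd E; s = sum_list E in
          E \<noteq> [] \<and> i < k \<and> distinct (i # (k - i) # E) \<and>
          list_all (\<lambda>x. 1 \<le> x \<and> x \<le> M \<and> x \<notin> set L) (i # (k - i) # E) \<and>
          M < s \<and> M + s < T \<and> 2 * s \<noteq> T \<and> s \<notin> set S \<and> T - s \<notin> set S) Es)"

lemma antimagic_certificate:
  assumes cert: "valid_certificate (m, ps, Es)" and E: "(i, E) \<in> set Es"
    and a: "length E = a + 1" and m: "m = a + b + 1" and c: "c = length ps + 1"
  shows "antimagic (star_paths a b c)"
proof -
  define M where "M = m + 2 * c"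
  define L where "L = map fst ps @ map snd ps"
  define S where "S = map (\<lambda>(x, y). x + y) ps"
  define k where "k = hd E"
  define U where "U = {1..M} - set L"
  define T where "T = M * (M + 1) div 2 - sum_list L"
  define good where "good = (\<lambda>(i, E). let k = hd E; s = sum_list E in
          E \<noteq> [] \<and> i < k \<and> distinct (i # (k - i) # E) \<and>
          list_all (\<lambda>x. 1 \<le> x \<and> x \<le> M \<and> x \<notin> set L) (i # (k - i) # E) \<and>
          M < s \<and> M + s < T \<and> 2 * s \<noteq> T \<and> s \<notin> set S \<and> T - s \<notin> set S)"
  have *: "distinct L" "distinct S" "list_all (\<lambda>x. 1 \<le> x \<and> x \<le> M) L" "list_all (\<lambda>s. M < s) S"
    "list_all good Es"
    using cert unfolding valid_certificate_def M_def L_def S_def T_def c good_def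
    by (simp_all only: prod.case Let_def)
  have "good (i, E)"
    using *(5) E by (simp add: list_all_iff)
  then have k: "E \<noteq> []" "i < k" "distinct (i # (k - i) # E)" "set (i # (k - i) # E) \<subseteq> U"
    and s: "M < sum_list E" "M + sum_list E < T" "2 * sum_list E \<noteq> T" "sum_list E \<notin> set S"
      "T - sum_list E \<notin> set S"
    unfolding good_def k_def U_def by (simp_all add: Let_def list_all_iff subset_iff)
  have L: "distinct L" "set L \<subseteq> {1..M}" and S: "distinct S" "\<And>s. s \<in> set S \<Longrightarrow> M < s"
    using *(1-4) by (auto simp: list_all_iff)
  have sum_E: "\<Sum>(set E) = sum_list E" and card_E: "card (set E) = a + 1"
    using k(3) a by (simp_all add: sum_list_distinct_conv_sum_set[of E "\<lambda>x. x", simplified] distinct_card)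
  have "\<Sum>(set L) = sum_list L"
    using L(1) sum_list_distinct_conv_sum_set[of L "\<lambda>x. x"] by simp
  moreover have "\<Sum>U = \<Sum>{1..M} - \<Sum>(set L)"
    unfolding U_def using L(2) by (intro sum_diff_nat) auto
  ultimately have sum_U: "\<Sum>U = T"
    using twice_sum_atLeastAtMost_1[of M] by (simp add: T_def)
  have "set ps = (!) ps ` {..<length ps}"
    by (auto simp: set_conv_nth)
  then have labels: "(\<lambda>n. fst (ps ! n)) ` {..<length ps} = set (map fst ps)"
    "(\<lambda>n. snd (ps ! n)) ` {..<length ps} = set (map snd ps)"
    by (simp_all add: image_image)
  have sums: "fst (ps ! n) + snd (ps ! n) = S ! n" if "n < length ps" for n
    using that by (simp add: S_def split_beta)
  have kE: "k \<in> set E" using k(1) by (simp add: k_def)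
  show ?thesis
  proof (rule antimagic_sufficient[of "{..<length ps}" c M a b "\<lambda>n. fst (ps ! n)" "\<lambda>n. snd (ps ! n)" U "set E" k i "k - i"])
    show "inj_on (\<lambda>n. fst (ps ! n)) {..<length ps}" "inj_on (\<lambda>n. snd (ps ! n)) {..<length ps}"
      using L(1) unfolding L_def distinct_append by (auto simp: distinct_conv_nth inj_on_def)
    show "(\<lambda>n. fst (ps ! n)) ` {..<length ps} \<inter> (\<lambda>n. snd (ps ! n)) ` {..<length ps} = {}"
      using L(1) unfolding labels by (simp only: L_def distinct_append)
    show "U \<inter> ((\<lambda>n. fst (ps ! n)) ` {..<length ps} \<union> (\<lambda>n. snd (ps ! n)) ` {..<length ps}) = {}"
      "U \<union> ((\<lambda>n. fst (ps ! n)) ` {..<length ps} \<union> (\<lambda>n. snd (ps ! n)) ` {..<length ps}) = {1..M}"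
      unfolding labels U_def using L(2) by (auto simp: L_def)
    show "inj_on (\<lambda>n. fst (ps ! n) + snd (ps ! n)) {..<length ps}"
      using S(1) by (auto simp: inj_on_def sums distinct_conv_nth S_def)
    fix n assume "n \<in> {..<length ps}"
    then have "fst (ps ! n) + snd (ps ! n) \<in> set S"
      by (auto simp: sums S_def)
    then show "M < fst (ps ! n) + snd (ps ! n)" "fst (ps ! n) + snd (ps ! n) \<noteq> \<Sum>(set E)"
      "fst (ps ! n) + snd (ps ! n) + \<Sum>(set E) \<noteq> \<Sum>U"
      using S(2) s unfolding sum_E sum_U by auto
  qed (use k kE card_E sum_E sum_U s c m in \<open>auto simp: M_def\<close>)
qed

text \<open>The first entry, with \<open>c = 2\<close> and \<open>M = 7\<close>, gives one path the
  labels 5, 6 and the other 3, 4; \<open>XY\<close> has 7, the leaf at \<open>X\<close> has 1, and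
  the leaf at \<open>Y\<close> the remaining 2. The sums at the two centres, \<open>X\<close> and
  \<open>Y\<close> are 11, 7, 8, 9.\<close>

definition certificates :: "(nat \<times> (nat \<times> nat) list \<times> (nat \<times> nat list) list) list" where
  "certificates =
    [(3, [(5, 6)], [(3, [7, 1])]),
      (4, [(5, 10), (7, 9), (8, 12)], [(1, [3, 11])]),
      (4, [(5, 14), (6, 12), (7, 10), (9, 11)], [(1, [3, 13])]),
      (5, [(7, 10), (9, 11), (12, 13)], [(1, [3, 5, 6])]),
      (5, [(6, 14), (8, 10), (9, 12), (13, 15)], [(1, [4, 5, 7])]),
      (5, [(6, 14), (7, 15), (8, 17), (10, 16), (11, 12)], [(1, [5, 13]), (1, [4, 5, 9])]),
      (5, [(6, 18), (7, 19), (8, 17), (9, 14), (10, 12), (13, 16)], [(1, [5, 15]), (1, [4, 5,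
        11])]),
      (6, [(7, 22), (9, 17), (10, 15), (11, 21), (12, 16), (13, 14), (19, 20)], [(1, [4, 2,
        18])]),
      (6, [(7, 23), (8, 21), (9, 18), (11, 17), (12, 22), (13, 19), (14, 24), (15, 16)], [(1,
        [6, 20]), (1, [4, 2, 20])]),
      (7, [(9, 15), (10, 13), (11, 16), (12, 17), (18, 20), (19, 21)], [(1, [8, 14])]),
      (7, [(9, 23), (10, 19), (11, 25), (12, 21), (13, 22), (14, 20), (15, 16), (18, 24)], [(1,
        [5, 6, 7, 8])]),
      (7, [(8, 24), (9, 25), (11, 20), (12, 18), (13, 22), (14, 23), (15, 21), (16, 17), (26,
        27)], [(1, [5, 6, 7, 10])]),
      (7, [(8, 28), (9, 26), (10, 22), (11, 27), (13, 18), (14, 20), (15, 24), (16, 21), (17,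
        25), (19, 29)], [(1, [7, 23]), (1, [3, 4, 23]), (1, [5, 6, 7, 12])]),
      (7, [(8, 30), (9, 24), (10, 26), (11, 31), (12, 22), (13, 28), (15, 29), (16, 21), (17,
        23), (18, 27), (19, 20)], [(1, [7, 25]), (1, [3, 4, 25]), (1, [5, 6, 7, 14])]),
      (8, [(10, 30), (11, 21), (12, 23), (13, 20), (14, 25), (15, 26), (16, 27), (17, 29), (18,
        19), (24, 28)], [(1, [9, 22])]),
      (8, [(9, 26), (11, 27), (12, 22), (13, 30), (14, 28), (15, 25), (16, 32), (17, 24), (18,
        29), (19, 20), (21, 31)], [(2, [10, 23]), (1, [3, 7, 23]), (1, [5, 2, 3, 23])]),
      (8, [(10, 33), (11, 28), (12, 25), (13, 34), (14, 30), (15, 23), (16, 24), (17, 29), (18,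
        27), (19, 31), (20, 22), (21, 32)], [(1, [5, 2, 3, 26])]),
      (8, [(9, 36), (10, 34), (12, 30), (13, 33), (14, 27), (15, 25), (16, 23), (17, 35), (18,
        32), (19, 24), (20, 29), (21, 26), (22, 31)], [(1, [5, 2, 3, 28])]),
      (9, [(11, 27), (12, 25), (13, 23), (14, 21), (15, 28), (16, 26), (17, 29), (18, 22), (19,
        20), (30, 31), (32, 33)], [(1, [10, 24]), (1, [3, 7, 24]), (1, [5, 2, 3, 24]), (1, [3,
        4, 8, 9, 10])]),
      (9, [(11, 31), (12, 25), (13, 27), (14, 29), (15, 23), (16, 28), (17, 22), (18, 30), (19,
        33), (20, 21), (24, 35), (32, 34)], [(1, [10, 26]), (1, [3, 7, 26]), (1, [5, 2, 3, 26]),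
        (1, [3, 6, 8, 9, 10])]),
      (9, [(11, 30), (12, 37), (13, 34), (14, 31), (15, 25), (16, 27), (17, 29), (18, 24), (19,
        32), (20, 28), (21, 23), (26, 36), (33, 35)], [(1, [4, 7, 8, 9, 10])]),
      (9, [(11, 38), (12, 34), (13, 29), (14, 27), (15, 39), (16, 31), (17, 33), (18, 25), (19,
        32), (20, 28), (21, 23), (22, 36), (24, 35), (26, 37)], [(1, [10, 30]), (1, [3, 7, 30]),
        (1, [5, 2, 3, 30]), (1, [6, 7, 8, 9, 10])]),
      (9, [(10, 38), (11, 40), (13, 41), (14, 29), (15, 37), (16, 39), (17, 36), (18, 26), (19,
        31), (20, 27), (21, 28), (22, 24), (23, 33), (25, 35), (32, 34)], [(3, [12, 30]), (1,
        [3, 9, 30]), (1, [3, 4, 5, 30]), (1, [6, 7, 8, 9, 12])]),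
      (9, [(10, 42), (11, 39), (12, 36), (13, 41), (14, 43), (15, 40), (16, 29), (17, 30), (18,
        28), (19, 32), (21, 38), (22, 31), (23, 26), (24, 34), (25, 37), (27, 33)], [(1, [9,
        35]), (1, [3, 6, 35]), (1, [7, 8, 9, 20]), (1, [3, 4, 8, 9, 20])]),
      (10, [(12, 38), (13, 33), (14, 28), (15, 39), (16, 27), (17, 31), (18, 26), (19, 32), (20,
        29), (21, 24), (22, 25), (23, 34), (35, 36), (37, 40)], [(1, [11, 30]), (1, [3, 8, 30]),
        (1, [4, 2, 5, 30]), (1, [3, 8, 9, 10, 11])]),
      (10, [(12, 37), (13, 40), (14, 42), (15, 39), (16, 29), (17, 31), (18, 28), (19, 33), (20,
        24), (21, 30), (22, 25), (23, 27), (26, 41), (34, 38), (35, 36)], [(1, [11, 32]), (1,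
        [3, 8, 32]), (1, [4, 2, 5, 32]), (1, [5, 8, 9, 10, 11])]),
      (10, [(12, 42), (13, 40), (14, 43), (15, 41), (16, 35), (17, 31), (18, 29), (19, 30), (20,
        32), (21, 25), (22, 28), (23, 39), (24, 36), (26, 44), (27, 37), (33, 38)], [(1, [11,
        34]), (1, [3, 8, 34]), (1, [4, 2, 5, 34]), (1, [7, 8, 9, 10, 11])]),
      (10, [(11, 45), (12, 46), (14, 40), (15, 42), (16, 32), (17, 44), (18, 41), (19, 33), (20,
        30), (21, 39), (22, 31), (23, 26), (24, 27), (25, 37), (28, 38), (29, 43), (35, 36)],
        [(3, [13, 34]), (1, [3, 10, 34]), (1, [3, 4, 6, 34]), (1, [7, 8, 9, 10, 13])]),
      (10, [(11, 47), (12, 44), (13, 48), (14, 43), (16, 46), (17, 42), (18, 37), (19, 31), (20,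
        45), (21, 32), (22, 41), (23, 28), (24, 30), (25, 27), (26, 38), (29, 40), (33, 35),
        (34, 36)], [(1, [10, 39]), (1, [3, 7, 39]), (1, [5, 2, 3, 39]), (1, [7, 8, 9, 10, 15])]),
      (11, [(13, 42), (14, 40), (15, 47), (16, 49), (17, 44), (18, 33), (19, 48), (20, 37), (21,
        35), (22, 31), (23, 29), (24, 36), (25, 34), (26, 32), (27, 41), (28, 45), (30, 46),
        (39, 43)], [(1, [12, 38]), (1, [3, 9, 38]), (1, [3, 4, 5, 38]), (1, [8, 9, 10, 11, 12]),
        (1, [3, 5, 9, 10, 11, 12])]),
      (11, [(12, 45), (13, 50), (15, 46), (16, 49), (17, 39), (18, 51), (19, 35), (20, 47), (21,
        37), (22, 31), (23, 32), (24, 40), (25, 34), (26, 36), (27, 33), (28, 43), (29, 44),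
        (30, 48), (41, 42)], [(3, [14, 38]), (1, [3, 11, 38]), (1, [3, 4, 7, 38]), (1, [8, 9,
        10, 11, 14]), (1, [3, 5, 9, 10, 11, 14])]),
      (11, [(12, 53), (13, 47), (14, 48), (16, 51), (17, 52), (18, 45), (19, 49), (20, 50), (21,
        36), (22, 33), (23, 35), (24, 37), (25, 31), (26, 38), (27, 32), (28, 43), (29, 44),
        (30, 42), (34, 41), (40, 46)], [(4, [15, 39]), (1, [4, 11, 39]), (1, [3, 4, 8, 39]), (1,
        [6, 2, 3, 4, 39]), (1, [3, 6, 9, 10, 11, 15])]),
      (12, [(13, 47), (14, 44), (16, 56), (17, 51), (18, 52), (19, 45), (20, 49), (21, 53), (22,
        37), (23, 48), (24, 43), (25, 38), (26, 35), (27, 39), (28, 34), (29, 36), (30, 46),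
        (31, 55), (32, 41), (33, 54), (40, 50)], [(3, [15, 42]), (1, [3, 12, 42]), (1, [3, 4, 8,
        42]), (1, [6, 2, 3, 4, 42]), (1, [3, 6, 10, 11, 12, 15])]),
      (12, [(13, 55), (14, 53), (16, 48), (17, 56), (18, 54), (19, 51), (20, 49), (21, 45), (22,
        43), (23, 37), (24, 47), (25, 52), (26, 50), (27, 35), (28, 57), (29, 32), (30, 33),
        (31, 58), (34, 41), (36, 46), (38, 42), (39, 40)], [(3, [15, 44]), (1, [3, 12, 44]), (1,
        [3, 4, 8, 44]), (1, [6, 2, 3, 4, 44]), (1, [3, 8, 10, 11, 12, 15])]),
      (12, [(13, 58), (14, 56), (16, 60), (17, 55), (18, 51), (19, 49), (20, 53), (21, 59), (22,
        52), (23, 44), (24, 57), (25, 54), (26, 37), (27, 39), (28, 36), (29, 33), (30, 47),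
        (31, 34), (32, 43), (35, 50), (38, 45), (40, 42), (41, 48)], [(3, [15, 46]), (1, [3, 12,
        46]), (1, [3, 4, 8, 46]), (1, [6, 2, 3, 4, 46]), (1, [4, 9, 10, 11, 12, 15])]),
      (13, [(14, 56), (16, 60), (17, 62), (18, 53), (19, 64), (20, 58), (21, 59), (22, 63), (23,
        61), (24, 57), (25, 50), (26, 41), (27, 47), (28, 45), (29, 39), (30, 42), (31, 38),
        (32, 54), (33, 55), (34, 43), (35, 52), (36, 46), (37, 65), (40, 49), (44, 48)], [(2,
        [15, 51]), (1, [3, 12, 51]), (1, [3, 4, 8, 51]), (1, [6, 2, 3, 4, 51]), (1, [5, 10, 11,
        12, 13, 15]), (1, [3, 4, 8, 11, 12, 13, 15])]),
      (15, [(17, 72), (19, 68), (20, 70), (21, 73), (22, 69), (23, 74), (24, 71), (25, 67), (26,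
        59), (27, 66), (28, 75), (29, 51), (30, 58), (31, 55), (32, 49), (33, 65), (34, 45),
        (35, 48), (36, 41), (37, 47), (38, 44), (39, 62), (40, 64), (42, 57), (43, 53), (46,
        63), (50, 56), (52, 60), (54, 61)], [(1, [13, 14, 15, 16, 18])])]"

lemma certificates_valid: "list_all valid_certificate certificates"
  by code_simp

definition certified :: "nat \<Rightarrow> nat \<Rightarrow> nat \<Rightarrow> bool" where
  "certified m a c \<longleftrightarrow> list_ex (\<lambda>(m', ps, Es). m = m' \<and> c = length ps + 1 \<and>
     list_ex (\<lambda>(i, E). length E = a + 1) Es) certificates"

lemma antimagic_certified:
  assumes "certified m a c" "m = a + b + 1"
  shows "antimagic (star_paths a b c)"
proof -
  obtain ps Es i E where *: "(m, ps, Es) \<in> set certificates" "c = length ps + 1" "(i, E) \<in> set Es" "length E = a + 1"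
    using assms(1) unfolding certified_def list_ex_iff by auto
  then have "valid_certificate (m, ps, Es)"
    using certificates_valid by (simp add: list_all_iff)
  then show ?thesis
    using antimagic_certificate * assms(2) by blast
qed

text \<open>For \<open>a = 7\<close> one has \<open>m = b + 8\<close>, so \<open>m < 30\<close> is
  the condition \<open>b \<le> 21\<close>.\<close>

definition max_copies :: "nat \<Rightarrow> nat \<Rightarrow> nat" where
  "max_copies m a = 2 * m + (if a \<le> 2 then 1 else if a \<le> 6 then a - 1 else if a = 7 \<and> m < 30 then 5 else 6)"

text \<open>The quadratic test is \<open>c \<le> \<tau> 0\<close> in integers, see
  \<open>le_tau_0_iff\<close>; the range of \<open>a\<close> expresses
  \<open>2 * a + 1 \<le> m\<close>, that is, \<open>a \<le> b\<close>.\<close>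

lemma small_cases:
  "\<forall>m\<in>set [3..<26]. \<forall>a\<in>set [1..<(m + 1) div 2]. \<forall>c\<in>set [1..<max_copies m a + 1].
     if c * c + 5 * c + m + 2 \<le> m * m + 2 * m * c then
       if zigzag_fits m a c then True else certified m a c
     else True"
  by code_simp

subsection \<open>The value of \<open>\<tau>\<close>\<close>

text \<open>Without paths no centre can take the sum \<open>k\<close>, so this case needs its own
  labeling: \<open>XY\<close> gets the largest label and the leaves at \<open>X\<close> the smallest
  ones.\<close>

lemma antimagic_no_copies:
  assumes "1 \<le> a" "a \<le> b"
  shows "antimagic (star_paths a b 0)"
proof -
  define l where "l = (\<lambda>u. case u of SXY \<Rightarrow> a + b + 1 | SX i \<Rightarrow> i + 1 | SY i \<Rightarrow> a + 1 + i | _ \<Rightarrow> 0)"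
  have S: "slots a b 0 = insert SXY (SX ` {..<a} \<union> SY ` {..<b})"
    by (auto simp: slots_def)
  have "l ` SX ` {..<a} = {1..<1 + a}" "l ` SY ` {..<b} = {a + 1..<a + 1 + b}"
    using image_add_lessThan[of 1 a] image_add_lessThan[of "a + 1" b] by (simp_all add: l_def image_image)
  then have leaves: "l ` (slots a b 0 - {SXY}) = {1..a + b}"
  proof -
    have "slots a b 0 - {SXY} = SX ` {..<a} \<union> SY ` {..<b}"
      by (auto simp: slots_def)
    moreover have "{1..<1 + a} \<union> {a + 1..<a + 1 + b} = {1..a + b}"
      by auto
    ultimately show ?thesis
      using \<open>l ` SX ` {..<a} = _\<close> \<open>l ` SY ` {..<b} = _\<close> by (simp only: image_Un)
  qed
  have "l ` slots a b 0 = insert (a + b + 1) (l ` (slots a b 0 - {SXY}))"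
    by (auto simp: S l_def)
  then have img: "l ` slots a b 0 = {1..a + b + 1 + 2 * 0}"
    unfolding leaves by auto
  then have inj: "inj_on l (slots a b 0)"
    by (intro eq_card_imp_inj_on) (simp_all add: card_slots)
  have "(\<Sum>i<a. i + 1) \<le> (\<Sum>i<b. i + 1)"
    using assms by (intro sum_mono2) auto
  also have "\<dots> < (\<Sum>i<b. a + 1 + i)"
    using assms by (intro sum_strict_mono) (auto simp: lessThan_empty_iff)
  finally have less: "slot_sum a b l (Inl X) < slot_sum a b l (Inl Y)"
    by (simp add: l_def)
  have "1 \<le> (\<Sum>i<a. i + 1)"
    using member_le_sum[of 0 "{..<a}" "\<lambda>i. i + 1"] assms by simp
  then have big: "a + b < slot_sum a b l (Inl X)"
    by (simp add: l_def)
  have "inj_on (slot_sum a b l) (leaf_of ` (slots a b 0 - {SXY}))"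
  proof (rule inj_on_imageI)
    have "inj_on l (slots a b 0 - {SXY})"
      using inj by (rule inj_on_subset) blast
    then show "inj_on (slot_sum a b l \<circ> leaf_of) (slots a b 0 - {SXY})"
      by (rule inj_on_cong[THEN iffD1, rotated]) (simp add: slot_sum_leaf_of)
  qed
  moreover have "slot_sum a b l ` leaf_of ` (slots a b 0 - {SXY}) = {1..a + b}"
    unfolding image_image leaves[symmetric] by (rule image_cong) (auto simp: slot_sum_leaf_of)
  ultimately have "inj_on (slot_sum a b l) (verts (star_paths a b 0))"
    unfolding verts_star_paths_leaf_of
    by (intro inj_on_UnI) (use less big in \<open>auto simp del: slot_sum.simps\<close>)
  then show ?thesis
    unfolding antimagic_star_paths_iff bij_betw_def using img inj by blast
qed

lemma antimagic_star_paths: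
  assumes "1 \<le> a" "a \<le> b" and m: "m = a + b + 1"
    and c: "c \<le> max_copies m a" "c * c + 5 * c + m + 2 \<le> m * m + 2 * m * c"
  shows "antimagic (star_paths a b c)"
proof (cases "c = 0")
  case True
  then show ?thesis using antimagic_no_copies assms by simp
next
  case False
  show ?thesis
  proof (cases "m < 26")
    case True
    then have "m \<in> set [3..<26]" "a \<in> set [1..<(m + 1) div 2]" "c \<in> set [1..<max_copies m a + 1]"
      unfolding set_upt using assms False by auto
    then have "zigzag_fits m a c \<or> certified m a c"
      using small_cases c(2) unfolding if_True_else by metis
    then show ?thesis
      using antimagic_zigzag_fits[OF m] antimagic_certified[OF _ m] False by auto
  next
    case m26: False
    show ?thesis
    proof (cases "a \<le> 7")
      case True
      show ?thesis
      proof (rule antimagic_small_a[OF assms(1) True _ m])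
        show "30 \<le> m" if "a = 7" "c = 2 * m + 6"
          using that c(1) by (auto simp: max_copies_def split: if_splits)
        show "c \<le> 2 * m + max 2 a - 1"
          using c(1) True by (auto simp: max_copies_def split: if_splits)
      qed (use m26 False in auto)
    next
      case a: False
      show ?thesis
        by (rule antimagic_large_a[OF _ assms(2) m])
          (use a m26 False c(1) in \<open>auto simp: max_copies_def split: if_splits\<close>)
    qed
  qed
qed

text \<open>For \<open>2 \<le> a \<le> 6\<close> and \<open>c = 2 * m + a\<close>, all terms with
  \<open>m\<close> cancel in the bound that involves \<open>X\<close>, and it fails by
  \<open>2 * (a - 1) * (a - 1)\<close>. For \<open>a = 1\<close> and \<open>c = 2 * m + 2\<close> it
  fails by \<open>2 * m + 2\<close>. For \<open>a = 7\<close> and \<open>c = 2 * m + 6\<close> it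
  reduces to \<open>30 \<le> m\<close>, the origin of the threshold for \<open>b\<close>.\<close>

lemma not_antimagic_star_paths:
  assumes "1 \<le> a" "a \<le> b" and m: "m = a + b + 1" and c: "c = max_copies m a + 1"
  shows "\<not> antimagic (star_paths a b c)"
proof
  assume "antimagic (star_paths a b c)"
  then obtain j where j: "j = c \<or> j + 1 = c"
    and le1: "2 * j * (m + 2 * c) + j * (j + 1) + (2 * j) * (2 * j) \<le> (2 * j) * (2 * (m + 2 * c) + 1)"
    and le2: "2 * (j + 1) * (m + 2 * c) + (j + 1) * (j + 2) + (2 * j + a + 1) * (2 * j + a + 1)
       \<le> (2 * j + a + 1) * (2 * (m + 2 * c) + 1)"
    using antimagic_necessary[of a b c "m + 2 * c"] assms by auto
  have "j * (5 * j) \<le> j * (2 * (m + 2 * c) + 1)"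
    using le1 by (simp add: algebra_simps)
  moreover have "j \<noteq> 0"
    using j c m by (auto simp: max_copies_def split: if_splits)
  ultimately have "5 * j \<le> 2 * (m + 2 * c) + 1"
    by (simp only: mult_le_cancel1)
  \<comment> \<open>The case \<open>j = c\<close> would give \<open>c \<le> 2 * m + 1\<close>, so
    one centre must have the sum \<open>k\<close>.\<close>
  with j c have j: "c = j + 1" "max_copies m a = j" "j \<le> 2 * m + 5"
    by (auto simp: max_copies_def split: if_splits)
  consider "a = 1 \<or> a = 2" "j = 2 * m + 1" | "3 \<le> a" "a \<le> 6" "j = 2 * m + a - 1" | "a = 7" "m < 30" "j = 2 * m + 5"
    using j assms(1) by (fastforce simp: max_copies_def split: if_splits)
  then show False
  proof cases
    case 1
    then show ?thesis using le2 j(1) by (auto simp: algebra_simps)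
  next
    case 2
    then have "a = 3 \<or> a = 4 \<or> a = 5 \<or> a = 6" by linarith
    then show ?thesis using le2 j(1) 2(3) by (auto simp: algebra_simps)
  next
    case 3
    then show ?thesis using le2 j(1) by (auto simp: algebra_simps)
  qed
qed

text \<open>Completing the square leads to \<open>u * u \<le> 2 * (v * v)\<close>. The difference of
  the two sides is \<open>4 * d - 1\<close>, and integrality of \<open>d\<close> absorbs the 1.
  Squaring is legitimate because \<open>u \<ge> - v\<close>.\<close>

lemma le_tau_0_iff:
  fixes m c :: nat
  assumes "3 \<le> m"
  shows "int c \<le> \<lfloor>(1 + sqrt 2) * (real m - 3 / 2)\<rfloor> - 1 \<longleftrightarrow>
     c * c + 5 * c + m + 2 \<le> m * m + 2 * m * c"
proof -
  define u where "u = 2 * int c + 5 - 2 * int m"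
  define v where "v = 2 * int m - 3"
  have "int c \<le> \<lfloor>(1 + sqrt 2) * (real m - 3 / 2)\<rfloor> - 1 \<longleftrightarrow>
      real_of_int (int c + 1) \<le> (1 + sqrt 2) * (real m - 3 / 2)"
    by (simp only: le_floor_iff[symmetric]) linarith
  also have "\<dots> \<longleftrightarrow> real_of_int u \<le> sqrt 2 * real_of_int v"
    by (simp add: u_def v_def field_simps)
  also have "\<dots> \<longleftrightarrow> \<bar>real_of_int u\<bar> \<le> \<bar>sqrt 2 * real_of_int v\<bar>"
  proof -
    have v: "0 < real_of_int v" "- real_of_int v \<le> real_of_int u"
      using assms by (simp_all add: u_def v_def)
    then have "1 * real_of_int v \<le> sqrt 2 * real_of_int v"
      by (intro mult_right_mono) auto
    then have "- real_of_int u \<le> sqrt 2 * real_of_int v"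
      using v(2) by linarith
    moreover have "\<bar>sqrt 2 * real_of_int v\<bar> = sqrt 2 * real_of_int v"
      using v(1) by simp
    ultimately show ?thesis by (simp only: abs_le_iff) blast
  qed
  also have "\<dots> \<longleftrightarrow> (real_of_int u)\<^sup>2 \<le> (sqrt 2 * real_of_int v)\<^sup>2"
    by (rule abs_le_square_iff)
  also have "\<dots> \<longleftrightarrow> real_of_int (u * u) \<le> real_of_int (2 * (v * v))"
  proof -
    have "(sqrt 2 * real_of_int v)\<^sup>2 = 2 * (real_of_int v)\<^sup>2"
      by (simp add: power_mult_distrib)
    then show ?thesis
      by (simp only: power2_eq_square of_int_mult of_int_numeral)
  qed
  also have "\<dots> \<longleftrightarrow> u * u \<le> 2 * (v * v)"
    by (rule of_int_le_iff)
  also have "\<dots> \<longleftrightarrow> int (c * c + 5 * c + m + 2) \<le> int (m * m + 2 * m * c)"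
  proof -
    define d where "d = int (c * c + 5 * c + m + 2) - int (m * m + 2 * m * c)"
    have "u * u - 2 * (v * v) = 4 * d - 1"
      by (simp add: u_def v_def d_def algebra_simps)
    then have "u * u \<le> 2 * (v * v) \<longleftrightarrow> 4 * d - 1 \<le> 0" by linarith
    also have "\<dots> \<longleftrightarrow> d \<le> 0" by presburger
    finally show ?thesis by (simp add: d_def)
  qed
  finally show ?thesis by (simp only: of_nat_le_iff)
qed

text \<open>\<open>tau\<close> stops at the first failure, so a single failure at
  \<open>t + 1\<close> suffices and no monotonicity in \<open>c\<close> is required.\<close>

lemma tau_eqI:
  assumes "0 \<le> t" "\<And>c. int c \<le> t \<Longrightarrow> antimagic (star_paths a b c)"
    "\<not> antimagic (star_paths a b (nat (t + 1)))"
  shows "tau (double_star a b) = Fin t"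
proof -
  have "antimagic (double_star a b)"
    using antimagic_double_star assms(1,2) by simp
  moreover have "(GREATEST t. \<forall>c. int c \<le> t \<longrightarrow> antimagic (star_paths a b c)) = t"
  proof (rule Greatest_equality)
    show "y \<le> t" if "\<forall>c. int c \<le> y \<longrightarrow> antimagic (star_paths a b c)" for y
      using that[rule_format, of "nat (t + 1)"] assms(1,3) by linarith
  qed (use assms(2) in blast)
  ultimately show ?thesis
    using assms(3) unfolding tau_def by auto
qed

lemma tau_double_star:
  assumes "1 \<le> a" "a \<le> b" and m: "m = a + b + 1"
  shows "tau (double_star a b) =
    Fin (min (\<lfloor>(1 + sqrt 2) * (real m - 3 / 2)\<rfloor> - 1) (int (max_copies m a)))"
proof (rule tau_eqI)
  let ?t0 = "\<lfloor>(1 + sqrt 2) * (real m - 3 / 2)\<rfloor> - 1"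
  have m3: "3 \<le> m" using assms by simp
  note iff = le_tau_0_iff[OF m3]
  have "m + 2 \<le> m * m"
    using mult_le_mono1[OF m3, of m] m3 by linarith
  then have "int 0 \<le> ?t0"
    unfolding iff by simp
  then have t0: "0 \<le> ?t0"
    by (simp only: of_nat_0)
  then show "0 \<le> min ?t0 (int (max_copies m a))"
    by (rule min.boundedI) simp
  show "antimagic (star_paths a b c)" if "int c \<le> min ?t0 (int (max_copies m a))" for c
    using that iff[of c] by (intro antimagic_star_paths[OF assms]) auto
  show "\<not> antimagic (star_paths a b (nat (min ?t0 (int (max_copies m a)) + 1)))"
  proof (cases "?t0 \<le> int (max_copies m a)")
    case True
    define c where "c = nat (?t0 + 1)"
    have c: "int c = ?t0 + 1"
      unfolding c_def using t0 by (intro nat_0_le) linarith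
    have "\<not> antimagic (star_paths a b c)"
    proof
      assume "antimagic (star_paths a b c)"
      then have "2 * (c + 1) * (m + 2 * c) + (c + 1) * (c + 2) \<le> (m + 2 * c) * (m + 2 * c + 1)"
        using antimagic_necessary[of a b c "m + 2 * c"] assms by auto
      then have "c * c + 5 * c + m + 2 \<le> m * m + 2 * m * c"
        by (simp add: algebra_simps)
      then show False using iff[of c] c by simp
    qed
    then show ?thesis using True by (simp add: c_def min_def)
  next
    case False
    then have "nat (min ?t0 (int (max_copies m a)) + 1) = max_copies m a + 1"
      by (simp add: nat_add_distrib min_def)
    then show ?thesis
      using not_antimagic_star_paths[OF assms refl] by (simp only: not_False_eq_True)
  qed
qed

theorem theorem2:
  fixes a b m :: nat and \<tau> :: "nat \<Rightarrow> int"
  assumes "1 \<le> a" and "a \<le> b"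
    and "m = a + b + 1"
    and "\<tau> 0 = \<lfloor>(1 + sqrt 2) * (real m - 3 / 2)\<rfloor> - 1"
    and "\<forall>i\<in>{1..6}. \<tau> i = 2 * int m + int i"
  shows "(1 \<le> a \<and> a \<le> 2 \<longrightarrow> tau (double_star a b) = Fin (min (\<tau> 0) (\<tau> 1))) \<and>
         (2 \<le> a \<and> a \<le> 6 \<longrightarrow> tau (double_star a b) = Fin (min (\<tau> 0) (\<tau> (a - 1)))) \<and>
         (a = 7 \<and> b \<le> 21 \<longrightarrow> tau (double_star a b) = Fin (min (\<tau> 0) (\<tau> 5))) \<and>
         (a = 7 \<and> 22 \<le> b \<or> 8 \<le> a \<longrightarrow> tau (double_star a b) = Fin (min (\<tau> 0) (\<tau> 6)))"
proof -
  have "tau (double_star a b) = Fin (min (\<tau> 0) (int (max_copies m a)))"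
    unfolding assms(4) using assms(1-3) by (rule tau_double_star)
  moreover have \<tau>: "\<tau> i = 2 * int m + int i" if "1 \<le> i" "i \<le> 6" for i
    using assms(5) that by simp
  have "a \<le> 2 \<Longrightarrow> int (max_copies m a) = \<tau> 1"
    "2 \<le> a \<Longrightarrow> a \<le> 6 \<Longrightarrow> int (max_copies m a) = \<tau> (a - 1)"
    "a = 7 \<Longrightarrow> b \<le> 21 \<Longrightarrow> int (max_copies m a) = \<tau> 5"
    "a = 7 \<and> 22 \<le> b \<or> 8 \<le> a \<Longrightarrow> int (max_copies m a) = \<tau> 6"
    using assms(3) \<tau> by (auto simp: max_copies_def)
  ultimately show ?thesis by auto
qed

end
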